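(* Let $I_1,I_2>0$ and let $\mathcal{G}=(V,E,\Phi,\{0,1\})$ be a random decision network with maximum degree $\Delta$ such that: for all $u\in V$, $\Phi_u(0)=0$ and $\Phi_u(1)$ is uniformly distributed on $[-I_1,I_1]$; for every $e\in E$, each of $\Phi_e(0,0),\Phi_e(1,0),\Phi_e(0,1),\Phi_e(1,1)$ is uniformly distributed on $[-I_2,I_2]$; and all these random variables (over all nodes, edges and actions) are mutually independent. Let $\beta=\frac{5I_2}{2I_1}$. If $\beta(\Delta-1)^2<1$, then there exists an additive FPTAS for finding $J_{\mathcal{G}}$ with high probability.
   Context: A decision network $\mathcal{G}=(V,E,\Phi,\chi)$ consists of a finite undirected simple graph $(V,E)$, a finite action set $\chi=\{0,1,\ldots,T-1\}$, a potential function $\Phi_v:\chi\to\mathbb{R}$ for every $v\in V$ and an interaction function $\Phi_e:\chi^2\to\mathbb{R}\cup\{-\infty\}$ for every $e\in E$. For a solution $\mathbf{x}=(x_v)_{v\in V}\in\chi^V$ put $F_{\mathcal{G}}(\mathbf{x})=\sum_{(u,v)\in E}\Phi_{u,v}(x_u,x_v)+\sum_{v\in V}\Phi_v(x_v)$, and let $J_{\mathcal{G}}=\max_{\mathbf{x}}F_{\mathcal{G}}(\mathbf{x})$. When $\Phi$ is random, its realization is observed and is the input of the algorithm. The degree bound $\Delta$ and the parameters $I_1,I_2$ are treated as fixed constants. An algorithm is an additive FPTAS with high probability for finding $J_{\mathcal{G}}$ if for every $\epsilon>0$ it outputs, in time polynomial in $|V|$ and $1/\epsilon$, a solution $\hat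 x$ such that $\mathbb{P}(J_{\mathcal{G}}-F_{\mathcal{G}}(\hat x)>\epsilon)<\epsilon$. *)

theory Defs
  imports "HOL-Probability.Probability" "HOL-Computational_Algebra.Polynomial"
begin

section \<open>Decision networks\<close>

text \<open>
  The vertices are \<open>0, \<dots>, num_nodes - 1\<close> and the actions are \<open>0, \<dots>, num_actions - 1\<close>.
  An undirected edge is stored once, as the pair \<open>(u, v)\<close> with \<open>u < v\<close>; its interaction function
  takes the action of \<open>u\<close> first and the action of \<open>v\<close> second.
\<close>

record network =
  num_nodes :: nat
  edges :: "(nat \<times> nat) set"
  num_actions :: nat
  potential :: "nat \<Rightarrow> nat \<Rightarrow> real"
  interaction :: "nat \<times> nat \<Rightarrow> nat \<Rightarrow> nat \<Rightarrow> ereal"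

definition decision_network :: "network \<Rightarrow> bool" where
  "decision_network G \<longleftrightarrow>
     edges G \<subseteq> {(u, v). u < v \<and> v < num_nodes G} \<and>
     0 < num_actions G \<and>
     (\<forall>e\<in>edges G. \<forall>a<num_actions G. \<forall>b<num_actions G. interaction G e a b \<noteq> \<infinity>)"

definition solutions :: "network \<Rightarrow> (nat \<Rightarrow> nat) set" where
  "solutions G = {..<num_nodes G} \<rightarrow>\<^sub>E {..<num_actions G}"

definition objective :: "network \<Rightarrow> (nat \<Rightarrow> nat) \<Rightarrow> ereal" where
  "objective G x =
     (\<Sum>(u, v)\<in>edges G. interaction G (u, v) (x u) (x v)) +
     (\<Sum>v<num_nodes G. ereal (potential G v (x v)))"

definition optimum :: "network \<Rightarrow> ereal" where
  "optimum G = Max (objective G ` solutions G)"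

definition node_degree :: "network \<Rightarrow> nat \<Rightarrow> nat" where
  "node_degree G v = card {u. (u, v) \<in> edges G \<or> (v, u) \<in> edges G}"

definition max_degree :: "network \<Rightarrow> nat" where
  "max_degree G = Max (insert 0 (node_degree G ` {..<num_nodes G}))"


section \<open>Algorithms over the reals\<close>

text \<open>
  Algorithms are programs of a first-order functional language whose data are finite binary trees
  with exact real numbers at the leaves. A program consists of finitely many, possibly mutually
  recursive functions and a main expression; it contains only integer constants.
  Running time is the number of applied evaluation rules, so that real addition, subtraction and
  comparison, and the construction and inspection of a cell, have unit cost, as in the real RAM
  model. There is neither multiplication nor rounding to an integer: on integer data, numbers grow
  by at most one bit per step, so that unit cost arithmetic gives no power beyond
  ordinary polynomial time.
\<close>

datatype val = Num real | Null | Cell val val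

datatype expr =
    Var nat
  | Const int
  | Add expr expr
  | Sub expr expr
  | If_le expr expr expr expr
  | Null_exp
  | Cell_exp expr expr
  | Case_exp expr expr expr expr
  | Let_exp expr expr
  | Call nat "expr list"

text \<open>
  Variables are de Bruijn indices into the environment, a list of values.
  \<open>Case_exp e e1 e2 e3\<close> continues with \<open>e1\<close> if \<open>e\<close> yields a number, with \<open>e2\<close> if it yields \<open>Null\<close>,
  and with \<open>e3\<close> if it yields a cell, whose components are then variables 0 and 1.
  \<open>eval P env e v t\<close> means that, with the function bodies \<open>P\<close>, the expression \<open>e\<close> evaluates to \<open>v\<close>
  in time \<open>t\<close>; an ill-formed or diverging expression has no value.
\<close>

inductive
  eval :: "expr list \<Rightarrow> val list \<Rightarrow> expr \<Rightarrow> val \<Rightarrow> nat \<Rightarrow> bool" and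
  evals :: "expr list \<Rightarrow> val list \<Rightarrow> expr list \<Rightarrow> val list \<Rightarrow> nat \<Rightarrow> bool"
  for P :: "expr list"
where
  Var: "i < length env \<Longrightarrow> eval P env (Var i) (env ! i) 1"
| Const: "eval P env (Const c) (Num (real_of_int c)) 1"
| Add: "\<lbrakk>eval P env e1 (Num x) t1; eval P env e2 (Num y) t2\<rbrakk>
    \<Longrightarrow> eval P env (Add e1 e2) (Num (x + y)) (t1 + t2 + 1)"
| Sub: "\<lbrakk>eval P env e1 (Num x) t1; eval P env e2 (Num y) t2\<rbrakk>
    \<Longrightarrow> eval P env (Sub e1 e2) (Num (x - y)) (t1 + t2 + 1)"
| If_le_True: "\<lbrakk>eval P env e1 (Num x) t1; eval P env e2 (Num y) t2; x \<le> y; eval P env e3 v t3\<rbrakk>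
    \<Longrightarrow> eval P env (If_le e1 e2 e3 e4) v (t1 + t2 + t3 + 1)"
| If_le_False: "\<lbrakk>eval P env e1 (Num x) t1; eval P env e2 (Num y) t2; \<not> x \<le> y; eval P env e4 v t4\<rbrakk>
    \<Longrightarrow> eval P env (If_le e1 e2 e3 e4) v (t1 + t2 + t4 + 1)"
| Null_exp: "eval P env Null_exp Null 1"
| Cell_exp: "\<lbrakk>eval P env e1 v1 t1; eval P env e2 v2 t2\<rbrakk>
    \<Longrightarrow> eval P env (Cell_exp e1 e2) (Cell v1 v2) (t1 + t2 + 1)"
| Case_Num: "\<lbrakk>eval P env e (Num x) t; eval P env e1 v t1\<rbrakk>
    \<Longrightarrow> eval P env (Case_exp e e1 e2 e3) v (t + t1 + 1)"
| Case_Null: "\<lbrakk>eval P env e Null t; eval P env e2 v t2\<rbrakk>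
    \<Longrightarrow> eval P env (Case_exp e e1 e2 e3) v (t + t2 + 1)"
| Case_Cell: "\<lbrakk>eval P env e (Cell a b) t; eval P (a # b # env) e3 v t3\<rbrakk>
    \<Longrightarrow> eval P env (Case_exp e e1 e2 e3) v (t + t3 + 1)"
| Let_exp: "\<lbrakk>eval P env e1 v1 t1; eval P (v1 # env) e2 v2 t2\<rbrakk>
    \<Longrightarrow> eval P env (Let_exp e1 e2) v2 (t1 + t2 + 1)"
| Call: "\<lbrakk>f < length P; evals P env es vs s; eval P vs (P ! f) v t\<rbrakk>
    \<Longrightarrow> eval P env (Call f es) v (s + t + 1)"
| evals_Nil: "evals P env [] [] 0"
| evals_Cons: "\<lbrakk>eval P env e v t; evals P env es vs s\<rbrakk>
    \<Longrightarrow> evals P env (e # es) (v # vs) (t + s)"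

inductive_cases eval_cases:
  "eval P env (Var i) w s" "eval P env (Const c) w s" "eval P env (Add e1 e2) w s"
  "eval P env (Sub e1 e2) w s" "eval P env (If_le e1 e2 e3 e4) w s" "eval P env Null_exp w s"
  "eval P env (Cell_exp e1 e2) w s" "eval P env (Case_exp e e1 e2 e3) w s"
  "eval P env (Let_exp e1 e2) w s" "eval P env (Call f es) w s"
  "evals P env [] ws s" "evals P env (e # es) ws s"

lemma eval_deterministic:
  "eval P env e v t \<Longrightarrow> \<forall>v' t'. eval P env e v' t' \<longrightarrow> v' = v \<and> t' = t"
  "evals P env es vs s \<Longrightarrow> \<forall>vs' s'. evals P env es vs' s' \<longrightarrow> vs' = vs \<and> s' = s"
  by (induction rule: eval_evals.inducts)
    ((intro allI impI, (erule eval_cases;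
      (metis val.inject val.distinct One_nat_def Suc_eq_plus1)))+)

type_synonym algorithm = "expr list \<times> expr"

fun enc_list :: "('a \<Rightarrow> val) \<Rightarrow> 'a list \<Rightarrow> val" where
  "enc_list enc [] = Null"
| "enc_list enc (x # xs) = Cell (enc x) (enc_list enc xs)"

definition enc_nat :: "nat \<Rightarrow> val" where
  "enc_nat n = Num (real n)"

text \<open>The interaction value \<open>-\<infinity>\<close> is encoded by \<open>Null\<close>.\<close>

definition enc_ereal :: "ereal \<Rightarrow> val" where
  "enc_ereal x = (if x = -\<infinity> then Null else Num (real_of_ereal x))"

definition enc_network :: "network \<Rightarrow> val" where
  "enc_network G = (let n = num_nodes G; T = num_actions G in
     Cell (enc_nat n) (Cell (enc_nat T) (Cell
       (enc_list (\<lambda>v. enc_list (\<lambda>a. Num (potential G v a)) [0..<T]) [0..<n])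
       (enc_list
          (\<lambda>(u, v). Cell (enc_nat u) (Cell (enc_nat v)
             (enc_list (\<lambda>a. enc_list (\<lambda>b. enc_ereal (interaction G (u, v) a b)) [0..<T]) [0..<T])))
          (filter (\<lambda>e. e \<in> edges G) (List.product [0..<n] [0..<n]))))))"

definition enc_solution :: "network \<Rightarrow> (nat \<Rightarrow> nat) \<Rightarrow> val" where
  "enc_solution G x = enc_list (\<lambda>v. enc_nat (x v)) [0..<num_nodes G]"

definition outputs_in_time :: "algorithm \<Rightarrow> real \<Rightarrow> network \<Rightarrow> (nat \<Rightarrow> nat) \<Rightarrow> nat \<Rightarrow> bool" where
  "outputs_in_time A \<epsilon> G x t \<longleftrightarrow>
     x \<in> solutions G \<and> eval (fst A) [Num \<epsilon>, enc_network G] (snd A) (enc_solution G x) t"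


section \<open>Additive FPTAS with high probability\<close>

text \<open>
  A random network is a function from a sample space to networks. The class \<open>\<C>\<close> consists of the
  random networks, with their probability spaces, on which the algorithm has to work; the algorithm
  and the polynomial \<open>p\<close>, in the two variables \<open>num_nodes\<close> and \<open>1 / \<epsilon>\<close>, are the same for the
  whole class and for all \<open>\<epsilon>\<close>. The time bound holds for every realization.
\<close>

definition additive_FPTAS_whp :: "algorithm \<Rightarrow> ('w measure \<times> ('w \<Rightarrow> network)) set \<Rightarrow> bool" where
  "additive_FPTAS_whp A \<C> \<longleftrightarrow>
     (\<exists>p :: real poly poly. \<forall>(M, G)\<in>\<C>. \<forall>\<epsilon>>0. \<exists>x :: 'w \<Rightarrow> nat \<Rightarrow> nat.
        (\<forall>\<omega>\<in>space M. \<exists>t. outputs_in_time A \<epsilon> (G \<omega>) (x \<omega>) t \<and>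
           real t \<le> poly (poly p [:real (num_nodes (G \<omega>)):]) (1 / \<epsilon>)) \<and>
        {\<omega> \<in> space M. optimum (G \<omega>) - objective (G \<omega>) (x \<omega>) > ereal \<epsilon>} \<in> sets M \<and>
        measure M {\<omega> \<in> space M. optimum (G \<omega>) - objective (G \<omega>) (x \<omega>) > ereal \<epsilon>} < \<epsilon>)"


section \<open>Uniformly distributed binary networks\<close>

datatype param = Node nat | Edge "nat \<times> nat" nat nat

definition uniform_on :: "'w measure \<Rightarrow> ('w \<Rightarrow> real) \<Rightarrow> real \<Rightarrow> bool" where
  "uniform_on M X r \<longleftrightarrow>
     distributed M lborel X (\<lambda>x. indicator {-r..r} x / measure lborel {-r..r})"

text \<open>
  \<open>X (Node u)\<close> is the random variable \<open>\<Phi>\<^sub>u(1)\<close>, and \<open>X (Edge e a b)\<close> is \<open>\<Phi>\<^sub>e(a, b)\<close>. The graph is not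
  random.
\<close>

definition binary_network ::
    "nat \<Rightarrow> (nat \<times> nat) set \<Rightarrow> (param \<Rightarrow> 'w \<Rightarrow> real) \<Rightarrow> 'w \<Rightarrow> network" where
  "binary_network n E X \<omega> =
     \<lparr>num_nodes = n, edges = E, num_actions = 2,
      potential = (\<lambda>u a. if a = 0 then 0 else X (Node u) \<omega>),
      interaction = (\<lambda>e a b. ereal (X (Edge e a b) \<omega>))\<rparr>"

definition uniform_random_network ::
    "real \<Rightarrow> real \<Rightarrow> nat \<Rightarrow> 'w measure \<Rightarrow> ('w \<Rightarrow> network) \<Rightarrow> bool" where
  "uniform_random_network I1 I2 \<Delta> M G \<longleftrightarrow>
     prob_space M \<and>
     (\<forall>\<omega>\<in>space M. decision_network (G \<omega>) \<and> max_degree (G \<omega>) \<le> \<Delta>) \<and>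
     (\<exists>n E X. G = binary_network n E X \<and>
        (\<forall>u<n. uniform_on M (X (Node u)) I1) \<and>
        (\<forall>e\<in>E. \<forall>a<2. \<forall>b<2. uniform_on M (X (Edge e a b)) I2) \<and>
        prob_space.indep_vars M (\<lambda>_. borel) X
          ({Node u | u. u < n} \<union> {Edge e a b | e a b. e \<in> E \<and> a < 2 \<and> b < 2}))"

end

theory Submission
  imports Defs
begin

text \<open>
  Up to a constant, the objective of a binary network is a quadratic function
  \<open>(\<Sum>v. h v * x v) + (\<Sum>(u, v). K (u, v) * x u * x v)\<close> of variables in \<open>{0, 1}\<close>. The field \<open>h v\<close> is
  \<open>\<Phi>\<^sub>v(1)\<close> plus differences of interactions, and a coupling \<open>K e\<close> is an alternating sum of the four
  interactions of \<open>e\<close>, so that \<open>\<bar>K e\<bar> \<le> 4 * I2\<close>. The bonus of \<open>v\<close> is the best value with \<open>x v = 1\<close> minus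
  the best value with \<open>x v = 0\<close>. If no bonus vanishes, the optimal solution is unique and sets \<open>x v = 1\<close>
  exactly where the bonus is positive (\<open>sign_solution_optimal\<close>); it remains to find the signs.

  Changing \<open>x v\<close> from 0 to 1 gains \<open>h v\<close>, deletes \<open>v\<close>, and adds the coupling \<open>K\<close> of each edge at \<open>v\<close> to
  the field of the neighbour \<open>w\<close>. Adding the couplings one neighbour at a time, each step changes the
  optimum of the network without \<open>v\<close> by \<open>max (B + K) 0 - max B 0\<close>, where \<open>B\<close> is the bonus of \<open>w\<close> in that
  network with the fields reached so far. Hence a bonus is an expression in bonuses of networks with
  fewer edges (\<open>bonus_eq_cavity\<close>). The algorithm unfolds this recursion to a depth \<open>r\<close> and puts 0 below.

  The error of the truncation decays exponentially. As a function of \<open>B\<close>, \<open>max (B + K) 0 - max B 0\<close>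
  has slope \<open>1\<close> or \<open>-1\<close> on an interval of length \<open>\<bar>K\<bar>\<close> and is constant elsewhere. Moreover
  \<open>B = \<Phi>\<^sub>w(1) + S\<close>, where \<open>S\<close> does not depend on \<open>\<Phi>\<^sub>w(1)\<close>, because \<open>w\<close> is deleted in the computation of
  \<open>S\<close>. As \<open>\<Phi>\<^sub>w(1)\<close> has density at most \<open>1 / (2 * I1)\<close>, averaging over it turns an error \<open>\<delta>\<close> of \<open>S\<close> into an
  expected error at most \<open>\<bar>K\<bar> * \<delta> / (2 * I1) \<le> (2 * I2 / I1) * \<delta>\<close> (\<open>density_at_most_response_diff\<close>). Below the root a
  node has at most \<open>\<Delta> - 1\<close> remaining neighbours, so that each level multiplies the expected error by at
  most \<open>q = 2 * (\<Delta> - 1) * I2 / I1\<close> (\<open>integral_cavity_diff\<close>), for every fixed choice of the couplings, and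
  \<open>\<beta> * (\<Delta> - 1)\<^sup>2 < 1\<close> yields \<open>q \<le> 4 / 5\<close>. An estimate has the wrong sign only if \<open>- \<Phi>\<^sub>v(1)\<close> lies between
  \<open>S\<close> and its estimate, which by the same bound on the density has probability at most \<open>E \<delta> / (2 * I1)\<close>.

  A union bound over the \<open>n\<close> nodes makes the failure probability \<open>O(n * q ^ r)\<close>. With \<open>r = 4 * j\<close>, where
  \<open>2 ^ j\<close> is of order \<open>n / \<epsilon>\<close>, it is below \<open>\<epsilon>\<close>, and the recursion tree has at most
  \<open>(\<Delta> + 1) ^ (r + 1)\<close> nodes up to a constant factor, which is polynomial in \<open>n / \<epsilon>\<close>. Outside the failure
  event the solution is even exactly optimal. The program is verified through an interpreter that is a
  recursive function (\<open>interp\<close>), so that running a function body is a computation by the simplifier.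
\<close>

section \<open>The cavity recursion\<close>

text \<open>
  The gain in \<open>max b 0\<close>, the optimum relative to action 0, when \<open>K\<close> is added to the field of a node with
  bonus \<open>b\<close>.
\<close>

definition response :: "real \<Rightarrow> real \<Rightarrow> real" where
  "response K b = max (b + K) 0 - max b 0"

definition incident :: "nat \<Rightarrow> nat \<times> nat \<Rightarrow> bool" where
  "incident v e \<longleftrightarrow> fst e = v \<or> snd e = v"

definition other :: "nat \<Rightarrow> nat \<times> nat \<Rightarrow> nat" where
  "other v e = (if fst e = v then snd e else fst e)"

definition arms :: "(nat \<times> nat \<Rightarrow> real) \<Rightarrow> nat \<Rightarrow> (nat \<times> nat) list \<Rightarrow> (nat \<times> real) list" where
  "arms k v Es = map (\<lambda>e. (other v e, k e)) (filter (incident v) Es)"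

definition delete_node :: "nat \<Rightarrow> (nat \<times> nat) list \<Rightarrow> (nat \<times> nat) list" where
  "delete_node v Es = filter (\<lambda>e. \<not> incident v e) Es"

text \<open>
  \<open>\<phi> w h\<close> stands for the part of the bonus of \<open>w\<close> that comes from its edges, in the network with fields
  \<open>h\<close>. A neighbour may be reached by several entries of the list; each of them sees the fields left by the
  entries before it.
\<close>

fun telescope :: "(nat \<Rightarrow> (nat \<Rightarrow> real) \<Rightarrow> real) \<Rightarrow> (nat \<times> real) list \<Rightarrow> (nat \<Rightarrow> real) \<Rightarrow> real" where
  "telescope \<phi> [] h = 0"
| "telescope \<phi> ((w, K) # N) h = response K (h w + \<phi> w h) + telescope \<phi> N (h(w := h w + K))"

text \<open>
  The contribution of the edges at \<open>v\<close> to its bonus, with 0 in place of everything below depth \<open>r\<close>. The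
  field of \<open>v\<close> itself is left out: the decay of errors rests on \<open>cavity\<close> being independent of it.
\<close>

fun cavity :: "(nat \<times> nat \<Rightarrow> real) \<Rightarrow> nat \<Rightarrow> (nat \<times> nat) list \<Rightarrow> nat \<Rightarrow> (nat \<Rightarrow> real) \<Rightarrow> real" where
  "cavity k 0 Es v h = 0"
| "cavity k (Suc r) Es v h = telescope (cavity k r (delete_node v Es)) (arms k v Es) h"

definition loopless :: "(nat \<times> nat) list \<Rightarrow> bool" where
  "loopless Es \<longleftrightarrow> (\<forall>e\<in>set Es. fst e \<noteq> snd e)"

definition endpoints :: "(nat \<times> nat) list \<Rightarrow> nat set" where
  "endpoints Es = fst ` set Es \<union> snd ` set Es"

lemma loopless_delete_node: "loopless Es \<Longrightarrow> loopless (delete_node v Es)"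
  by (auto simp: loopless_def delete_node_def)

lemma endpoints_delete_node: "endpoints (delete_node v Es) \<subseteq> endpoints Es - {v}"
  by (auto simp: endpoints_def delete_node_def incident_def)

lemma arms_endpoints: "loopless Es \<Longrightarrow> (w, K) \<in> set (arms k v Es) \<Longrightarrow> w \<in> endpoints Es - {v}"
  by (force simp: arms_def endpoints_def other_def incident_def loopless_def split: if_splits)

lemma arms_coupling: "(w, K) \<in> set (arms k v Es) \<Longrightarrow> \<exists>e\<in>set Es. K = k e"
  by (auto simp: arms_def)

lemma arms_cong: "(\<And>e. e \<in> set Es \<Longrightarrow> k e = k' e) \<Longrightarrow> arms k v Es = arms k' v Es"
  by (auto simp: arms_def)

lemma length_delete_node_less: "arms k v Es \<noteq> [] \<Longrightarrow> length (delete_node v Es) < length Es"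
proof -
  assume "arms k v Es \<noteq> []"
  then have "length (filter (incident v) Es) > 0" by (auto simp: arms_def)
  then show ?thesis
    using sum_length_filter_compl[of "incident v" Es] unfolding delete_node_def by linarith
qed

lemma telescope_cong:
  assumes "\<And>w K h h'. (w, K) \<in> set N \<Longrightarrow> (\<forall>u\<in>S. h u = h' u) \<Longrightarrow> \<phi> w h = \<phi>' w h'"
    and "\<And>w K. (w, K) \<in> set N \<Longrightarrow> w \<in> S" and "\<forall>u\<in>S. h u = h' u"
  shows "telescope \<phi> N h = telescope \<phi>' N h'"
  using assms
proof (induction \<phi> N h arbitrary: h' rule: telescope.induct)
  case (2 \<phi> w K N h)
  have "telescope \<phi> N (h(w := h w + K)) = telescope \<phi>' N (h'(w := h' w + K))"
    using 2 by (intro "2.IH") (auto, blast+)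
  moreover have "\<phi> w h = \<phi>' w h'" "h w = h' w"
    using "2.prems"(1)[of w K h h'] "2.prems"(2)[of w K] "2.prems"(3) by simp_all
  ultimately show ?case by simp
qed simp

text \<open>
  The field of the root \<open>v\<close> is never read: after \<open>v\<close> has been deleted, only fields at endpoints of the
  remaining edges are looked up.
\<close>

lemma cavity_cong:
  assumes "loopless Es" "\<And>e. e \<in> set Es \<Longrightarrow> k e = k' e" "\<forall>w\<in>endpoints Es - {v}. h w = h' w"
  shows "cavity k r Es v h = cavity k' r Es v h'"
  using assms
proof (induction r arbitrary: Es v h h')
  case (Suc r)
  have "telescope (cavity k r (delete_node v Es)) (arms k v Es) h = telescope (cavity k' r (delete_node v Es)) (arms k v Es) h'"
  proof (rule telescope_cong[where S = "endpoints Es - {v}"])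
    fix w K and h h' :: "nat \<Rightarrow> real"
    assume "\<forall>u\<in>endpoints Es - {v}. h u = h' u"
    then show "cavity k r (delete_node v Es) w h = cavity k' r (delete_node v Es) w h'"
      using Suc.prems endpoints_delete_node[of v Es]
      by (intro Suc.IH) (auto simp: loopless_delete_node, auto simp: delete_node_def)
  qed (use Suc.prems arms_endpoints in blast)+
  then show ?case using arms_cong[of Es k k'] Suc.prems by simp
qed simp

lemma response_bound: "\<bar>response K b\<bar> \<le> \<bar>K\<bar>"
  by (auto simp: response_def max_def)

lemma telescope_bound: "(\<And>w K. (w, K) \<in> set N \<Longrightarrow> \<bar>K\<bar> \<le> W) \<Longrightarrow> \<bar>telescope \<phi> N h\<bar> \<le> real (length N) * W"
proof (induction \<phi> N h rule: telescope.induct)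
  case (2 \<phi> w K N h)
  have "\<bar>response K (h w + \<phi> w h)\<bar> \<le> W"
    using response_bound[of K "h w + \<phi> w h"] "2.prems"[of w K] by simp
  moreover have "\<bar>telescope \<phi> N (h(w := h w + K))\<bar> \<le> real (length N) * W"
    using "2.prems" by (intro "2.IH") auto
  ultimately show ?case by (simp add: algebra_simps)
qed simp

section \<open>Exactness of the full recursion\<close>

text \<open>
  Quadratic unconstrained binary optimization, the normal form of a binary network.
\<close>

definition qubo :: "nat \<Rightarrow> (nat \<Rightarrow> real) \<Rightarrow> (nat \<times> nat \<Rightarrow> real) \<Rightarrow> (nat \<times> nat) list \<Rightarrow> (nat \<Rightarrow> nat) \<Rightarrow> real" where
  "qubo n h k Es x = (\<Sum>v<n. h v * real (x v)) + (\<Sum>e\<leftarrow>Es. k e * real (x (fst e)) * real (x (snd e)))"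

abbreviation sols :: "nat \<Rightarrow> (nat \<Rightarrow> nat) set" where
  "sols n \<equiv> {..<n} \<rightarrow>\<^sub>E {..<2}"

definition peak where "peak n h k Es = Max (qubo n h k Es ` sols n)"

definition peak_at where "peak_at n h k Es v b = Max (qubo n h k Es ` {x \<in> sols n. x v = b})"

definition bonus where "bonus n h k Es v = peak_at n h k Es v 1 - peak_at n h k Es v 0"

lemma finite_sols: "finite (sols n)"
  by (intro finite_PiE) auto

lemma sols_at_nonempty: "v < n \<Longrightarrow> b < 2 \<Longrightarrow> {x \<in> sols n. x v = b} \<noteq> {}"
proof -
  assume "v < n" "b < 2"
  then have "(\<lambda>u\<in>{..<n}. b) \<in> {x \<in> sols n. x v = b}" by simp
  then show ?thesis by blast
qed

lemma sols_split: "v < n \<Longrightarrow> sols n = {x \<in> sols n. x v = 1} \<union> {x \<in> sols n. x v = 0}"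
proof -
  assume "v < n"
  then have "x v = 1 \<or> x v = 0" if "x \<in> sols n" for x
    using PiE_mem[OF that, of v] \<open>v < n\<close> less_2_cases by fastforce
  then show ?thesis by (intro equalityI subsetI) auto
qed

lemma peak_split:
  assumes "v < n"
  shows "peak n h k Es = max (peak_at n h k Es v 1) (peak_at n h k Es v 0)"
proof -
  have "peak n h k Es = Max (qubo n h k Es ` {x \<in> sols n. x v = 1} \<union> qubo n h k Es ` {x \<in> sols n. x v = 0})"
    unfolding peak_def image_Un[symmetric] by (rule arg_cong[OF sols_split[OF assms]])
  also have "\<dots> = max (peak_at n h k Es v 1) (peak_at n h k Es v 0)"
    unfolding peak_at_def
    using sols_at_nonempty[OF assms] finite_sols[of n]
    by (intro Max_Un) (simp_all only: finite_imageI finite_subset[OF Collect_restrict] image_is_empty, simp_all)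
  finally show ?thesis .
qed

lemma Max_image_add:
  fixes f g :: "'a \<Rightarrow> real"
  assumes "finite A" "A \<noteq> {}" "\<And>x. x \<in> A \<Longrightarrow> f x = c + g x"
  shows "Max (f ` A) = c + Max (g ` A)"
proof -
  have "f ` A = (\<lambda>x. g x + c) ` A" using assms(3) by (intro image_cong) auto
  then show ?thesis using Max_add_commute[of A g c] assms(1,2) by simp
qed

lemma qubo_bump:
  assumes "w < n"
  shows "qubo n (h(w := h w + K)) k Es x = K * real (x w) + qubo n h k Es x"
proof -
  have "(\<Sum>v<n. (h(w := h w + K)) v * real (x v)) = (\<Sum>v<n. h v * real (x v) + (if v = w then K * real (x w) else 0))"
    by (intro sum.cong) (auto simp: algebra_simps)
  also have "\<dots> = (\<Sum>v<n. h v * real (x v)) + K * real (x w)"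
    using assms by (simp add: sum.distrib)
  finally show ?thesis by (simp add: qubo_def)
qed

lemma peak_at_bump:
  assumes "w < n" "b < 2"
  shows "peak_at n (h(w := h w + K)) k Es w b = K * real b + peak_at n h k Es w b"
  unfolding peak_at_def
  using sols_at_nonempty[OF assms] finite_sols[of n]
  by (intro Max_image_add) (auto simp: qubo_bump[OF assms(1)])

text \<open>
  Relative to action 0 of \<open>w\<close>, the optimum is \<open>max B 0\<close> for the bonus \<open>B\<close> of \<open>w\<close>, and a change of the field
  of \<open>w\<close> affects only the solutions with action 1.
\<close>

lemma peak_bump:
  assumes "w < n"
  shows "peak n (h(w := h w + K)) k Es - peak n h k Es = response K (bonus n h k Es w)"
  using peak_at_bump[OF assms, of 0 h K k Es] peak_at_bump[OF assms, of 1 h K k Es]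
  by (simp add: peak_split[OF assms] response_def bonus_def max_def)

fun bump_all :: "(nat \<times> real) list \<Rightarrow> (nat \<Rightarrow> real) \<Rightarrow> nat \<Rightarrow> real" where
  "bump_all [] h = h"
| "bump_all ((w, K) # N) h = bump_all N (h(w := h w + K))"

text \<open>
  Telescoping: each summand is the gain of one bump by \<open>peak_bump\<close>.
\<close>

lemma telescope_exact:
  assumes "\<And>w K h. (w, K) \<in> set N \<Longrightarrow> h w + \<phi> w h = bonus n h k Es w"
    and "\<And>w K. (w, K) \<in> set N \<Longrightarrow> w < n"
  shows "telescope \<phi> N h = peak n (bump_all N h) k Es - peak n h k Es"
  using assms
proof (induction \<phi> N h rule: telescope.induct)
  case (2 \<phi> w K N h)
  have "telescope \<phi> N (h(w := h w + K)) = peak n (bump_all N (h(w := h w + K))) k Es - peak n (h(w := h w + K)) k Es"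
  proof (rule "2.IH")
    show "h w' + \<phi> w' h = bonus n h k Es w'" if "(w', K') \<in> set N" for w' K' h
      using "2.prems"(1)[of w' K' h] that by simp
    show "w' < n" if "(w', K') \<in> set N" for w' K'
      using "2.prems"(2)[of w' K'] that by simp
  qed
  moreover have "response K (h w + \<phi> w h) = peak n (h(w := h w + K)) k Es - peak n h k Es"
    using "2.prems" peak_bump[of w n h K k Es] by (metis list.set_intros(1))
  ultimately show ?case by simp
qed simp

lemma qubo_bump_all:
  assumes "\<And>w K. (w, K) \<in> set N \<Longrightarrow> w < n"
  shows "qubo n (bump_all N h) k Es x = (\<Sum>(w, K)\<leftarrow>N. K * real (x w)) + qubo n h k Es x"
  using assms
proof (induction N h rule: bump_all.induct)
  case (2 w K N h)
  have "qubo n (bump_all N (h(w := h w + K))) k Es x = (\<Sum>(w, K)\<leftarrow>N. K * real (x w)) + qubo n (h(w := h w + K)) k Es x"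
    by (rule "2.IH") (use "2.prems" in auto)
  then show ?case using qubo_bump[of w n h K k Es x] "2.prems"[of w K] by simp
qed simp

text \<open>
  Splitting off all terms that involve \<open>v\<close>. Those of its edges become fields at the neighbours, in force
  only if \<open>x v = 1\<close>.
\<close>

lemma qubo_remove:
  assumes "loopless Es" "v < n" "x v < 2"
  shows "qubo n h k Es x = (h v + (\<Sum>(w, K)\<leftarrow>arms k v Es. K * real (x w))) * real (x v) +
    qubo n (h(v := 0)) k (delete_node v Es) x"
proof -
  have "(\<Sum>u<n. h u * real (x u)) = (\<Sum>u<n. (h(v := 0)) u * real (x u) + (if u = v then h v * real (x v) else 0))"
    by (intro sum.cong) auto
  also have "\<dots> = (\<Sum>u<n. (h(v := 0)) u * real (x u)) + h v * real (x v)"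
    using assms by (simp add: sum.distrib)
  finally have 1: "(\<Sum>u<n. h u * real (x u)) = (\<Sum>u<n. (h(v := 0)) u * real (x u)) + h v * real (x v)" .
  have "(\<Sum>e\<leftarrow>Es. k e * real (x (fst e)) * real (x (snd e))) =
      (\<Sum>(w, K)\<leftarrow>arms k v Es. K * real (x w)) * real (x v) +
      (\<Sum>e\<leftarrow>delete_node v Es. k e * real (x (fst e)) * real (x (snd e)))"
    using assms(1)
  proof (induction Es)
    case (Cons e Es)
    then have "loopless Es" "fst e \<noteq> snd e" by (auto simp: loopless_def)
    then show ?case
      using Cons.IH by (auto simp: arms_def delete_node_def incident_def other_def algebra_simps)
  qed (simp add: arms_def delete_node_def)
  then show ?thesis using 1 by (simp add: qubo_def algebra_simps)
qed

lemma qubo_upd: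
  assumes "h v = 0" "v \<notin> endpoints Es"
  shows "qubo n h k Es (x(v := b)) = qubo n h k Es x"
proof -
  have "(\<Sum>e\<leftarrow>Es. k e * real ((x(v := b)) (fst e)) * real ((x(v := b)) (snd e))) =
      (\<Sum>e\<leftarrow>Es. k e * real (x (fst e)) * real (x (snd e)))"
    using assms(2) by (intro arg_cong[where f = sum_list] map_cong) (auto simp: endpoints_def image_iff)
  moreover have "(\<Sum>u<n. h u * real ((x(v := b)) u)) = (\<Sum>u<n. h u * real (x u))"
    using assms(1) by (intro sum.cong) auto
  ultimately show ?thesis unfolding qubo_def by (simp only:)
qed

lemma peak_at_free:
  assumes "h v = 0" "v \<notin> endpoints Es" "v < n" "b < 2"
  shows "peak_at n h k Es v b = peak n h k Es"
proof -
  have "qubo n h k Es x \<in> qubo n h k Es ` {x \<in> sols n. x v = b}" if "x \<in> sols n" for x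
  proof (rule image_eqI)
    show "qubo n h k Es x = qubo n h k Es (x(v := b))"
      using qubo_upd[of h v Es n k x b] assms by simp
    show "x(v := b) \<in> {x \<in> sols n. x v = b}"
      using that assms by (auto simp: PiE_iff extensional_def)
  qed
  then have "qubo n h k Es ` {x \<in> sols n. x v = b} = qubo n h k Es ` sols n" by auto
  then show ?thesis by (simp add: peak_at_def peak_def)
qed

lemma bump_all_other: "(\<And>K. (v, K) \<notin> set N) \<Longrightarrow> bump_all N h v = h v"
  by (induction N h rule: bump_all.induct) force+

text \<open>
  With \<open>x v\<close> fixed to 1 or 0, the network is the one without \<open>v\<close>, with or without the couplings at \<open>v\<close>
  added to the fields of the neighbours; the difference of the two optima telescopes. Depth
  \<open>length Es\<close> suffices because a recursive call occurs only where an edge has been deleted.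
\<close>

theorem bonus_eq_cavity:
  assumes "loopless Es" "endpoints Es \<subseteq> {..<n}" "v < n" "length Es \<le> r"
  shows "h v + cavity k r Es v h = bonus n h k Es v"
  using assms
proof (induction r arbitrary: Es v h)
  case 0
  have "bonus n h k Es v = h v"
  proof -
    have e: "Es = []" using 0 by simp
    have "bonus n h k [] v = (h v + peak_at n (h(v := 0)) k [] v 1) - peak_at n (h(v := 0)) k [] v 0"
      using peak_at_bump[OF 0(3), of 1 "h(v := 0)" "h v" k "[]"] peak_at_bump[OF 0(3), of 0 "h(v := 0)" "h v" k "[]"]
      by (simp add: bonus_def)
    then show ?thesis
      using peak_at_free[of "h(v := 0)" v "[]" n _ k] 0(3) by (simp add: endpoints_def e)
  qed
  then show ?case by simp
next
  case (Suc r)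
  let ?N = "arms k v Es" and ?R = "delete_node v Es" and ?h = "h(v := 0)"
  have N: "w < n" "w \<in> endpoints Es - {v}" if "(w, K) \<in> set ?N" for w K
    using arms_endpoints[OF Suc.prems(1) that] Suc.prems(2) by auto
  have R: "loopless ?R" "endpoints ?R \<subseteq> {..<n}" "v \<notin> endpoints ?R"
    using loopless_delete_node[OF Suc.prems(1)] endpoints_delete_node[of v Es] Suc.prems(2) by auto
  \<comment> \<open>With field 0 and no edges, \<open>v\<close> is decoupled, so that fixing its action does not change the optimum.\<close>
  have b: "bump_all ?N ?h v = 0"
    using N(2) bump_all_other[of v ?N ?h] by fastforce
  have "peak_at n h k Es v 1 = h v + peak_at n (bump_all ?N ?h) k ?R v 1"
    unfolding peak_at_def
  proof (rule Max_image_add)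
    fix x assume "x \<in> {x \<in> sols n. x v = 1}"
    then show "qubo n h k Es x = h v + qubo n (bump_all ?N ?h) k ?R x"
      using qubo_remove[OF Suc.prems(1,3), of x h k] qubo_bump_all[of ?N n ?h k ?R x] N(1) by auto
  qed (use sols_at_nonempty[OF Suc.prems(3), of 1] finite_sols[of n] in auto)
  moreover have "peak_at n h k Es v 0 = 0 + peak_at n ?h k ?R v 0"
    unfolding peak_at_def
  proof (rule Max_image_add)
    fix x assume "x \<in> {x \<in> sols n. x v = 0}"
    then show "qubo n h k Es x = 0 + qubo n ?h k ?R x"
      using qubo_remove[OF Suc.prems(1,3), of x h k] by auto
  qed (use sols_at_nonempty[OF Suc.prems(3), of 0] finite_sols[of n] in auto)
  ultimately have "bonus n h k Es v = h v + (peak n (bump_all ?N ?h) k ?R - peak n ?h k ?R)"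
    using peak_at_free[where h = "bump_all ?N ?h", OF b R(3) Suc.prems(3)] peak_at_free[of ?h v ?R n] R(3) Suc.prems(3)
    by (simp add: bonus_def)
  also have "peak n (bump_all ?N ?h) k ?R - peak n ?h k ?R = telescope (cavity k r ?R) ?N ?h"
  proof (rule telescope_exact[symmetric])
    fix w K h assume wK: "(w, K) \<in> set ?N"
    then have "length ?R < length Es" by (intro length_delete_node_less[of k]) auto
    then show "h w + cavity k r ?R w h = bonus n h k ?R w"
      using R N(1)[OF wK] Suc.prems(4) by (intro Suc.IH) auto
  qed (use N in blast)
  also have "telescope (cavity k r ?R) ?N ?h = cavity k (Suc r) Es v h"
    using cavity_cong[OF Suc.prems(1), of k k v ?h h "Suc r"] by simp
  finally show ?case by (rule sym)
qed

lemma peak_attained: "\<exists>x\<in>sols n. qubo n h k Es x = peak n h k Es"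
proof -
  have "(\<lambda>u\<in>{..<n}. 0) \<in> sols n" by simp
  then have "qubo n h k Es ` sols n \<noteq> {}" by blast
  then have "peak n h k Es \<in> qubo n h k Es ` sols n"
    unfolding peak_def by (rule Max_in[OF finite_imageI[OF finite_sols]])
  then show ?thesis by (rule imageE) metis
qed

text \<open>
  An optimal solution must follow the sign of every nonzero bonus.
\<close>

lemma sign_solution_optimal:
  assumes "\<And>v. v < n \<Longrightarrow> bonus n h k Es v \<noteq> 0"
  shows "qubo n h k Es (\<lambda>v\<in>{..<n}. if bonus n h k Es v > 0 then 1 else 0) = peak n h k Es"
proof -
  obtain y where y: "y \<in> sols n" and opt: "qubo n h k Es y = peak n h k Es"
    using peak_attained[of n h k Es] by (elim bexE)
  have "y v = (if bonus n h k Es v > 0 then 1 else 0)" if v: "v < n" for v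
  proof -
    have y2: "y v = 0 \<or> y v = 1"
      using PiE_mem[OF y, of v] v less_2_cases by fastforce
    have "qubo n h k Es y \<in> qubo n h k Es ` {x \<in> sols n. x v = y v}"
      using y by blast
    moreover have "finite (qubo n h k Es ` {x \<in> sols n. x v = y v})"
      by (rule finite_imageI[OF finite_subset[OF Collect_restrict finite_sols]])
    ultimately have "qubo n h k Es y \<le> peak_at n h k Es v (y v)"
      unfolding peak_at_def by (intro Max_ge)
    then have "max (peak_at n h k Es v 1) (peak_at n h k Es v 0) \<le> peak_at n h k Es v (y v)"
      using opt peak_split[OF v, of h k Es] by linarith
    with y2 assms[OF v] show ?thesis by (auto simp: bonus_def)
  qed
  then have "y = (\<lambda>v\<in>{..<n}. if bonus n h k Es v > 0 then 1 else 0)"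
    using y by (intro PiE_ext[OF y]) auto
  then show ?thesis using opt by simp
qed

section \<open>Decay of the truncation error\<close>

text \<open>
  Having a density that is bounded by \<open>c\<close>, in the form of an inequality of integrals, which is how it is
  used.
\<close>

definition density_at_most :: "real \<Rightarrow> real measure \<Rightarrow> bool" where
  "density_at_most c U \<longleftrightarrow> 0 \<le> c \<and> prob_space U \<and> sets U = sets borel \<and>
    (\<forall>f\<in>borel_measurable borel. (\<integral>\<^sup>+x. f x \<partial>U) \<le> ennreal c * (\<integral>\<^sup>+x. f x \<partial>lborel))"

lemma density_at_most_nn_integral:
  "density_at_most c U \<Longrightarrow> f \<in> borel_measurable borel \<Longrightarrow> (\<integral>\<^sup>+x. f x \<partial>U) \<le> ennreal c * (\<integral>\<^sup>+x. f x \<partial>lborel)"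
  by (simp add: density_at_most_def)

lemma density_at_most_indicator:
  assumes "density_at_most c U"
  shows "(\<integral>\<^sup>+z. indicator {z. min (z + a) (z + b) \<le> 0 \<and> 0 \<le> max (z + a) (z + b)} z \<partial>U) \<le> ennreal (c * \<bar>a - b\<bar>)"
proof -
  have eq: "{z. min (z + a) (z + b) \<le> 0 \<and> 0 \<le> max (z + a) (z + b)} = {- max a b .. - min a b}"
    by (auto simp: min_def max_def)
  have "(\<integral>\<^sup>+z. indicator {- max a b .. - min a b} z \<partial>U) \<le> ennreal c * (\<integral>\<^sup>+z. indicator {- max a b .. - min a b} z \<partial>lborel)"
    by (rule density_at_most_nn_integral[OF assms]) measurable
  also have "(\<integral>\<^sup>+z. indicator {- max a b .. - min a b} z \<partial>lborel) = ennreal (\<bar>a - b\<bar>)"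
    by (subst nn_integral_indicator) (auto simp: min_def max_def abs_real_def intro!: arg_cong[where f = ennreal])
  also have "ennreal c * ennreal \<bar>a - b\<bar> = ennreal (c * \<bar>a - b\<bar>)"
    using assms by (simp add: density_at_most_def ennreal_mult)
  finally show ?thesis by (simp only: eq)
qed

lemma response_measurable [measurable]:
  assumes [measurable]: "f \<in> borel_measurable M" "g \<in> borel_measurable M"
  shows "(\<lambda>x. response (f x) (g x)) \<in> borel_measurable M"
  unfolding response_def by measurable

text \<open>
  \<open>response K\<close> has slope \<open>1\<close> or \<open>-1\<close> between \<open>- K\<close> and 0 and slope 0 elsewhere; its increment is therefore
  bounded by the length that this interval shares with the one between the two arguments, here shifted
  by \<open>z\<close>.
\<close>

lemma response_diff_le_overlap:
  "ennreal \<bar>response K (z + a) - response K (z + b)\<bar> \<le>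
    emeasure lborel {max (min a b) (min 0 (- K) - z) .. min (max a b) (max 0 (- K) - z)}"
  unfolding emeasure_lborel_Icc_eq
  by (intro ennreal_leI) (auto simp: response_def max_def min_def abs_real_def split: if_splits)

text \<open>
  The contraction of errors. By Fubini, the overlap of the interval between \<open>z + a\<close> and \<open>z + b\<close> with a
  fixed interval of length \<open>\<bar>K\<bar>\<close>, integrated over all real \<open>z\<close>, is \<open>\<bar>a - b\<bar> * \<bar>K\<bar>\<close>.
\<close>

lemma density_at_most_response_diff:
  assumes "density_at_most c U"
  shows "(\<integral>\<^sup>+z. ennreal \<bar>response K (z + a) - response K (z + b)\<bar> \<partial>U) \<le> ennreal (c * \<bar>K\<bar> * \<bar>a - b\<bar>)"
proof -
  define A where "A = {min a b .. max a b}"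
  define B where "B = {min 0 (- K) .. max 0 (- K)}"
  have [measurable]: "A \<in> sets borel" "B \<in> sets borel" by (auto simp: A_def B_def)
  have "(\<integral>\<^sup>+z. ennreal \<bar>response K (z + a) - response K (z + b)\<bar> \<partial>U) \<le>
      ennreal c * (\<integral>\<^sup>+z. ennreal \<bar>response K (z + a) - response K (z + b)\<bar> \<partial>lborel)"
    by (rule density_at_most_nn_integral[OF assms]) measurable
  also have "(\<integral>\<^sup>+z. ennreal \<bar>response K (z + a) - response K (z + b)\<bar> \<partial>lborel) \<le>
      (\<integral>\<^sup>+z. (\<integral>\<^sup>+t. indicator A t * indicator B (t + z) \<partial>lborel) \<partial>lborel)"
  proof (rule nn_integral_mono)
    fix z :: real
    have "(\<integral>\<^sup>+t. indicator A t * indicator B (t + z) \<partial>lborel) =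
        (\<integral>\<^sup>+t. indicator {max (min a b) (min 0 (- K) - z) .. min (max a b) (max 0 (- K) - z)} t \<partial>lborel)"
      by (intro nn_integral_cong) (auto simp: A_def B_def indicator_def)
    then show "ennreal \<bar>response K (z + a) - response K (z + b)\<bar> \<le> (\<integral>\<^sup>+t. indicator A t * indicator B (t + z) \<partial>lborel)"
      using response_diff_le_overlap[of K z a b] by simp
  qed
  also have "\<dots> = (\<integral>\<^sup>+t. (\<integral>\<^sup>+z. indicator A t * indicator B (t + z) \<partial>lborel) \<partial>lborel)"
    by (rule lborel_pair.Fubini') measurable
  also have "\<dots> = (\<integral>\<^sup>+t. indicator A t * ennreal \<bar>K\<bar> \<partial>lborel)"
  proof (rule nn_integral_cong)
    fix t :: real
    have "(\<integral>\<^sup>+z. indicator B (t + z) \<partial>lborel) = (\<integral>\<^sup>+z. indicator {min 0 (- K) - t .. max 0 (- K) - t} z \<partial>lborel)"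
      by (intro nn_integral_cong) (auto simp: B_def indicator_def)
    also have "\<dots> = ennreal \<bar>K\<bar>"
      by (subst nn_integral_indicator) (auto simp: min_def max_def abs_real_def)
    finally show "(\<integral>\<^sup>+z. indicator A t * indicator B (t + z) \<partial>lborel) = indicator A t * ennreal \<bar>K\<bar>"
      by (subst nn_integral_cmult) auto
  qed
  also have "\<dots> = ennreal \<bar>a - b\<bar> * ennreal \<bar>K\<bar>"
    by (subst nn_integral_multc) (auto simp: A_def min_def max_def abs_real_def)
  also have "ennreal c * (ennreal \<bar>a - b\<bar> * ennreal \<bar>K\<bar>) = ennreal (c * \<bar>K\<bar> * \<bar>a - b\<bar>)"
    using assms by (simp add: density_at_most_def ennreal_mult mult_ac)
  finally show ?thesis by (simp add: mult_left_mono)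
qed

text \<open>
  Replacing one coordinate by an independent copy keeps the law of a product. This permits to average
  over one field while all others stay fixed.
\<close>

lemma (in product_prob_space) nn_integral_resample:
  assumes I: "finite I" "i \<in> I" and f: "f \<in> borel_measurable (PiM I M)"
  shows "(\<integral>\<^sup>+z. f z \<partial>PiM I M) = (\<integral>\<^sup>+z. (\<integral>\<^sup>+y. f (z(i := y)) \<partial>M i) \<partial>PiM I M)"
proof -
  define J where "J = I - {i}"
  have IJ: "I = insert i J" "finite J" "i \<notin> J" using I by (auto simp: J_def)
  note [measurable] = f[unfolded IJ(1)]
  have [measurable]: "(\<lambda>(z, y). f (z(i := y))) \<in> borel_measurable (PiM (insert i J) M \<Otimes>\<^sub>M M i)"
  proof -
    have "(\<lambda>(z, y). z(i := y)) \<in> measurable (PiM (insert i J) M \<Otimes>\<^sub>M M i) (PiM (insert i J) M)"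
      using measurable_add_dim[of i "insert i J" M] by simp
    from measurable_comp[OF this f[unfolded IJ(1)]] show ?thesis
      by (simp add: comp_def split_def)
  qed
  have "(\<integral>\<^sup>+z. (\<integral>\<^sup>+y. f (z(i := y)) \<partial>M i) \<partial>PiM (insert i J) M) =
      (\<integral>\<^sup>+x. (\<integral>\<^sup>+y'. (\<integral>\<^sup>+y. f ((x(i := y'))(i := y)) \<partial>M i) \<partial>M i) \<partial>PiM J M)"
    using IJ by (subst product_nn_integral_insert) (auto intro!: sigma_finite_measure.borel_measurable_nn_integral)
  also have "\<dots> = (\<integral>\<^sup>+x. (\<integral>\<^sup>+y. f (x(i := y)) \<partial>M i) \<partial>PiM J M)"
    by (simp add: M.emeasure_space_1)
  also have "\<dots> = (\<integral>\<^sup>+z. f z \<partial>PiM (insert i J) M)"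
    using IJ by (subst product_nn_integral_insert) auto
  finally show ?thesis by (simp add: IJ(1))
qed

text \<open>
  Measurability is asked only of the fields at nodes in \<open>S\<close>, since the fields at other numbers need not
  be random variables.
\<close>

lemma measurable_telescope:
  fixes k :: "'a \<Rightarrow> nat \<times> nat \<Rightarrow> real"
  assumes "\<And>e h. e \<in> set F \<Longrightarrow> \<forall>u\<in>S. (\<lambda>\<omega>. h \<omega> u) \<in> borel_measurable Q \<Longrightarrow>
      (\<lambda>\<omega>. \<phi> \<omega> (other v e) (h \<omega>)) \<in> borel_measurable Q"
    and "\<And>e. e \<in> set F \<Longrightarrow> other v e \<in> S"
    and "\<And>e. e \<in> set F \<Longrightarrow> (\<lambda>\<omega>. k \<omega> e) \<in> borel_measurable Q"
    and "\<forall>u\<in>S. (\<lambda>\<omega>. h \<omega> u) \<in> borel_measurable Q"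
  shows "(\<lambda>\<omega>. telescope (\<phi> \<omega>) (map (\<lambda>e. (other v e, k \<omega> e)) F) (h \<omega>)) \<in> borel_measurable Q"
  using assms
proof (induction F arbitrary: h)
  case (Cons e F)
  have [measurable]: "(\<lambda>\<omega>. \<phi> \<omega> (other v e) (h \<omega>)) \<in> borel_measurable Q"
    using Cons.prems(1)[of e h] Cons.prems(4) by simp
  have [measurable]: "(\<lambda>\<omega>. h \<omega> (other v e)) \<in> borel_measurable Q" "(\<lambda>\<omega>. k \<omega> e) \<in> borel_measurable Q"
    using Cons.prems(2)[of e] Cons.prems(3)[of e] Cons.prems(4) by auto
  have [measurable]: "(\<lambda>\<omega>. telescope (\<phi> \<omega>) (map (\<lambda>e. (other v e, k \<omega> e)) F)
      ((h \<omega>)(other v e := h \<omega> (other v e) + k \<omega> e))) \<in> borel_measurable Q"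
  proof (rule Cons.IH)
    show "\<forall>u\<in>S. (\<lambda>\<omega>. ((h \<omega>)(other v e := h \<omega> (other v e) + k \<omega> e)) u) \<in> borel_measurable Q"
    proof
      fix u assume "u \<in> S"
      then show "(\<lambda>\<omega>. ((h \<omega>)(other v e := h \<omega> (other v e) + k \<omega> e)) u) \<in> borel_measurable Q"
        using Cons.prems(4) by (cases "u = other v e") auto
    qed
  qed (use Cons.prems(1-3) in auto)
  show ?case by simp
qed simp

lemma measurable_cavity:
  assumes "loopless Es"
    and "\<And>e. e \<in> set Es \<Longrightarrow> (\<lambda>\<omega>. k \<omega> e) \<in> borel_measurable Q"
    and "\<forall>u\<in>endpoints Es - {v}. (\<lambda>\<omega>. h \<omega> u) \<in> borel_measurable Q"
  shows "(\<lambda>\<omega>. cavity (k \<omega>) r Es v (h \<omega>)) \<in> borel_measurable Q"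
  using assms
proof (induction r arbitrary: Es v h)
  case (Suc r)
  have "(\<lambda>\<omega>. telescope (cavity (k \<omega>) r (delete_node v Es)) (map (\<lambda>e. (other v e, k \<omega> e)) (filter (incident v) Es)) (h \<omega>))
    \<in> borel_measurable Q"
  proof (rule measurable_telescope[where S = "endpoints Es - {v}"])
    fix e and h :: "'a \<Rightarrow> nat \<Rightarrow> real"
    assume "\<forall>u\<in>endpoints Es - {v}. (\<lambda>\<omega>. h \<omega> u) \<in> borel_measurable Q"
    then show "(\<lambda>\<omega>. cavity (k \<omega>) r (delete_node v Es) (other v e) (h \<omega>)) \<in> borel_measurable Q"
      using Suc.prems(1,2) endpoints_delete_node[of v Es]
      by (intro Suc.IH) (auto simp: loopless_delete_node, auto simp: delete_node_def)
  next
    fix e assume "e \<in> set (filter (incident v) Es)"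
    then show "other v e \<in> endpoints Es - {v}"
      using arms_endpoints[OF Suc.prems(1), of "other v e" "0" "\<lambda>_. 0" v] by (auto simp: arms_def)
  qed (use Suc.prems in auto)
  then show ?case by (simp add: arms_def)
qed simp

text \<open>
  Independent random fields with bounded densities. The injection \<open>\<nu>\<close> places the field of a node among
  the coordinates of a larger product, which also contains the parameters of the edges.
\<close>

locale random_fields = product_prob_space D "\<nu> ` {..<n}"
  for D :: "'i \<Rightarrow> real measure" and \<nu> :: "nat \<Rightarrow> 'i" and n :: nat +
  fixes c :: real
  assumes inj: "inj \<nu>" and density_at_most: "\<And>v. v < n \<Longrightarrow> density_at_most c (D (\<nu> v))"
begin

abbreviation "P \<equiv> PiM (\<nu> ` {..<n}) D"

definition field :: "(nat \<Rightarrow> real) \<Rightarrow> ('i \<Rightarrow> real) \<Rightarrow> nat \<Rightarrow> real" where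
  "field h z u = h u + z (\<nu> u)"

lemma field_upd: "field h (z(\<nu> w := y)) = (field h z)(w := h w + y)"
  using inj by (auto simp: field_def fun_eq_iff inj_eq)

lemma field_bump: "(field h z)(w := field h z w + K) = field (h(w := h w + K)) z"
  by (auto simp: field_def fun_eq_iff)

lemma measurable_field: "u < n \<Longrightarrow> (\<lambda>z. field h z u) \<in> borel_measurable P"
proof -
  assume u: "u < n"
  have "(\<lambda>z. z (\<nu> u)) \<in> measurable P (D (\<nu> u))"
    using u by (intro measurable_component_singleton) auto
  also have "measurable P (D (\<nu> u)) = borel_measurable P"
    using density_at_most[OF u] by (intro measurable_cong_sets) (auto simp: density_at_most_def)
  finally have [measurable]: "(\<lambda>z. z (\<nu> u)) \<in> borel_measurable P" .
  show ?thesis unfolding field_def by measurable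
qed

lemma c_nonneg: "v < n \<Longrightarrow> 0 \<le> c"
  using density_at_most by (auto simp: density_at_most_def)

text \<open>
  \<open>f\<close> and \<open>g\<close> play the true and the estimated contribution of the edges at \<open>w\<close>. As neither depends on the
  field of \<open>w\<close>, that field can be averaged over first.
\<close>

lemma integral_response_diff:
  fixes f g :: "(nat \<Rightarrow> real) \<Rightarrow> real"
  assumes w: "w < n" and K: "\<bar>K\<bar> \<le> W"
    and free: "\<And>h x. f (h(w := x)) = f h" "\<And>h x. g (h(w := x)) = g h"
    and [measurable]: "(\<lambda>z. f (field h z)) \<in> borel_measurable P" "(\<lambda>z. g (field h z)) \<in> borel_measurable P"
  shows "(\<integral>\<^sup>+z. ennreal \<bar>response K (field h z w + f (field h z)) - response K (field h z w + g (field h z))\<bar> \<partial>P)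
    \<le> ennreal (c * W) * (\<integral>\<^sup>+z. ennreal \<bar>f (field h z) - g (field h z)\<bar> \<partial>P)"
proof -
  note [measurable] = measurable_field[OF w, of h]
  have "(\<integral>\<^sup>+z. ennreal \<bar>response K (field h z w + f (field h z)) - response K (field h z w + g (field h z))\<bar> \<partial>P) =
      (\<integral>\<^sup>+z. (\<integral>\<^sup>+y. ennreal \<bar>response K (field h (z(\<nu> w := y)) w + f (field h (z(\<nu> w := y)))) -
        response K (field h (z(\<nu> w := y)) w + g (field h (z(\<nu> w := y))))\<bar> \<partial>D (\<nu> w)) \<partial>P)"
    using w by (intro nn_integral_resample) auto
  also have "\<dots> = (\<integral>\<^sup>+z. (\<integral>\<^sup>+y. ennreal \<bar>response K (y + (h w + f (field h z))) - response K (y + (h w + g (field h z)))\<bar> \<partial>D (\<nu> w)) \<partial>P)"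
    by (simp add: field_upd free add_ac)
  also have "\<dots> \<le> (\<integral>\<^sup>+z. ennreal (c * W) * ennreal \<bar>f (field h z) - g (field h z)\<bar> \<partial>P)"
  proof (rule nn_integral_mono)
    fix z
    have "(\<integral>\<^sup>+y. ennreal \<bar>response K (y + (h w + f (field h z))) - response K (y + (h w + g (field h z)))\<bar> \<partial>D (\<nu> w))
        \<le> ennreal (c * \<bar>K\<bar> * \<bar>f (field h z) - g (field h z)\<bar>)"
      using density_at_most_response_diff[OF density_at_most[OF w], of K "h w + f (field h z)" "h w + g (field h z)"] by simp
    also have "\<dots> \<le> ennreal (c * W * \<bar>f (field h z) - g (field h z)\<bar>)"
      using K c_nonneg[OF w] by (intro ennreal_leI mult_right_mono mult_left_mono) auto
    also have "\<dots> = ennreal (c * W) * ennreal \<bar>f (field h z) - g (field h z)\<bar>"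
      using K c_nonneg[OF w] by (intro ennreal_mult) auto
    finally show "(\<integral>\<^sup>+y. ennreal \<bar>response K (y + (h w + f (field h z))) - response K (y + (h w + g (field h z)))\<bar> \<partial>D (\<nu> w))
        \<le> ennreal (c * W) * ennreal \<bar>f (field h z) - g (field h z)\<bar>" .
  qed
  also have "\<dots> = ennreal (c * W) * (\<integral>\<^sup>+z. ennreal \<bar>f (field h z) - g (field h z)\<bar> \<partial>P)"
    by (rule nn_integral_cmult) measurable
  finally show ?thesis .
qed

lemma integral_telescope_diff:
  assumes "\<And>w K. (w, K) \<in> set N \<Longrightarrow> w < n \<and> \<bar>K\<bar> \<le> W"
    and "\<And>w K h x. (w, K) \<in> set N \<Longrightarrow> \<phi> w (h(w := x)) = \<phi> w h \<and> \<psi> w (h(w := x)) = \<psi> w h"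
    and "\<And>w K h. (w, K) \<in> set N \<Longrightarrow> (\<lambda>z. \<phi> w (field h z)) \<in> borel_measurable P \<and> (\<lambda>z. \<psi> w (field h z)) \<in> borel_measurable P"
    and "\<And>w K h. (w, K) \<in> set N \<Longrightarrow> (\<integral>\<^sup>+z. ennreal \<bar>\<phi> w (field h z) - \<psi> w (field h z)\<bar> \<partial>P) \<le> A"
  shows "(\<lambda>z. telescope \<phi> N (field h z)) \<in> borel_measurable P \<and> (\<lambda>z. telescope \<psi> N (field h z)) \<in> borel_measurable P \<and>
    (\<integral>\<^sup>+z. ennreal \<bar>telescope \<phi> N (field h z) - telescope \<psi> N (field h z)\<bar> \<partial>P) \<le> of_nat (length N) * (ennreal (c * W) * A)"
  using assms
proof (induction N arbitrary: h)
  case (Cons a N)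
  obtain w K where a: "a = (w, K)" by (cases a)
  let ?h = "h(w := h w + K)"
  have IH: "(\<lambda>z. telescope \<phi> N (field ?h z)) \<in> borel_measurable P" "(\<lambda>z. telescope \<psi> N (field ?h z)) \<in> borel_measurable P"
    "(\<integral>\<^sup>+z. ennreal \<bar>telescope \<phi> N (field ?h z) - telescope \<psi> N (field ?h z)\<bar> \<partial>P) \<le> of_nat (length N) * (ennreal (c * W) * A)"
  proof (atomize (full), rule Cons.IH)
    fix w' K' h' x assume N: "(w', K') \<in> set N"
    show "w' < n \<and> \<bar>K'\<bar> \<le> W" by (rule Cons.prems(1)[OF list.set_intros(2)[OF N]])
    show "\<phi> w' (h'(w' := x)) = \<phi> w' h' \<and> \<psi> w' (h'(w' := x)) = \<psi> w' h'" by (rule Cons.prems(2)[OF list.set_intros(2)[OF N]])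
    show "(\<lambda>z. \<phi> w' (field h' z)) \<in> borel_measurable P \<and> (\<lambda>z. \<psi> w' (field h' z)) \<in> borel_measurable P"
      by (rule Cons.prems(3)[OF list.set_intros(2)[OF N]])
    show "(\<integral>\<^sup>+z. ennreal \<bar>\<phi> w' (field h' z) - \<psi> w' (field h' z)\<bar> \<partial>P) \<le> A"
      by (rule Cons.prems(4)[OF list.set_intros(2)[OF N]])
  qed
  have w: "w < n" "\<bar>K\<bar> \<le> W" using Cons.prems(1)[of w K] by (auto simp: a)
  have aN: "(w, K) \<in> set (a # N)" by (simp add: a)
  have free: "\<phi> w (h(w := x)) = \<phi> w h" "\<psi> w (h(w := x)) = \<psi> w h" for h x
    using Cons.prems(2)[of w K h x, OF aN] by blast+
  have meas: "(\<lambda>z. \<phi> w (field h z)) \<in> borel_measurable P" "(\<lambda>z. \<psi> w (field h z)) \<in> borel_measurable P"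
    using Cons.prems(3)[of w K h] by (auto simp: a)
  note [measurable] = IH(1,2) meas measurable_field[OF w(1), of h]
  let ?d = "\<lambda>z. ennreal \<bar>response K (field h z w + \<phi> w (field h z)) - response K (field h z w + \<psi> w (field h z))\<bar>"
  have "(\<integral>\<^sup>+z. ennreal \<bar>telescope \<phi> (a # N) (field h z) - telescope \<psi> (a # N) (field h z)\<bar> \<partial>P) \<le>
      (\<integral>\<^sup>+z. ?d z + ennreal \<bar>telescope \<phi> N (field ?h z) - telescope \<psi> N (field ?h z)\<bar> \<partial>P)"
    by (intro nn_integral_mono) (auto simp: a field_bump ennreal_plus[symmetric] simp del: ennreal_plus intro!: ennreal_leI)
  also have "\<dots> = (\<integral>\<^sup>+z. ?d z \<partial>P) + (\<integral>\<^sup>+z. ennreal \<bar>telescope \<phi> N (field ?h z) - telescope \<psi> N (field ?h z)\<bar> \<partial>P)"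
    by (rule nn_integral_add) measurable
  also have "\<dots> \<le> ennreal (c * W) * A + of_nat (length N) * (ennreal (c * W) * A)"
  proof (rule add_mono[OF order_trans[OF integral_response_diff[OF w free meas]] IH(3)])
    show "ennreal (c * W) * (\<integral>\<^sup>+z. ennreal \<bar>\<phi> w (field h z) - \<psi> w (field h z)\<bar> \<partial>P) \<le> ennreal (c * W) * A"
      using Cons.prems(4)[of w K h] by (auto simp: a intro: mult_left_mono)
  qed
  also have "\<dots> = of_nat (length (a # N)) * (ennreal (c * W) * A)"
    by (simp add: algebra_simps)
  finally show ?case by (simp add: a field_bump)
qed simp

lemma cavity_free: "loopless Es \<Longrightarrow> cavity k r Es v (h(v := x)) = cavity k r Es v h"
  by (rule cavity_cong) auto

lemma measurable_cavity_field:
  assumes "loopless Es" "endpoints Es \<subseteq> {..<n}"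
  shows "(\<lambda>z. cavity k r Es v (field h z)) \<in> borel_measurable P"
  using assms measurable_field by (intro measurable_cavity) auto

text \<open>
  Exponential decay of the truncation error. Every neighbour \<open>w\<close> of the root has lost the edge to the
  root, hence at most \<open>\<Delta> - 1\<close> edges remain at \<open>w\<close>; each contributes a factor \<open>c * W\<close>. At depth 0 the error is
  at most \<open>W\<close> for each edge at \<open>v\<close>, as \<open>response\<close> is bounded by the coupling.
\<close>

lemma integral_cavity_diff:
  assumes "loopless Es" "endpoints Es \<subseteq> {..<n}" "\<And>e. e \<in> set Es \<Longrightarrow> \<bar>k e\<bar> \<le> W" "0 \<le> W" "0 \<le> c"
    and "\<And>u. length (filter (incident u) Es) \<le> \<Delta>" "length (filter (incident v) Es) \<le> m" "r \<le> r'"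
  shows "(\<integral>\<^sup>+z. ennreal \<bar>cavity k r Es v (field h z) - cavity k r' Es v (field h z)\<bar> \<partial>P) \<le>
    ennreal (real m * W * (real (\<Delta> - 1) * c * W) ^ r)"
  using assms(1-3,6-)
proof (induction r arbitrary: Es v h m r')
  case 0
  have "\<bar>cavity k r' Es v h\<bar> \<le> real m * W" for h
  proof (cases r')
    case (Suc r'')
    have "\<bar>cavity k r' Es v h\<bar> \<le> real (length (arms k v Es)) * W"
      unfolding Suc cavity.simps using 0(3) arms_coupling by (intro telescope_bound) blast
    also have "\<dots> \<le> real m * W"
      using 0(5) assms(4) by (intro mult_right_mono) (auto simp: arms_def)
    finally show ?thesis .
  qed (use assms(4) in simp)
  then have "(\<integral>\<^sup>+z. ennreal \<bar>cavity k 0 Es v (field h z) - cavity k r' Es v (field h z)\<bar> \<partial>P) \<le> (\<integral>\<^sup>+z. ennreal (real m * W) \<partial>P)"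
    by (intro nn_integral_mono ennreal_leI) simp
  also have "\<dots> = ennreal (real m * W)" by (simp add: emeasure_space_1)
  finally show ?case by simp
next
  case (Suc r)
  obtain s where s: "r' = Suc s" "r \<le> s" using Suc.prems(6) by (cases r') auto
  let ?R = "delete_node v Es" and ?N = "arms k v Es"
  let ?A = "real (\<Delta> - 1) * W * (real (\<Delta> - 1) * c * W) ^ r"
  have R: "loopless ?R" "endpoints ?R \<subseteq> {..<n}"
    using loopless_delete_node[OF Suc.prems(1)] endpoints_delete_node[of v Es] Suc.prems(2) by auto
  have deg: "length (filter (incident u) ?R) \<le> length (filter (incident u) Es)" for u
    unfolding delete_node_def filter_filter by (induction Es) auto
  have "(\<integral>\<^sup>+z. ennreal \<bar>telescope (cavity k r ?R) ?N (field h z) - telescope (cavity k s ?R) ?N (field h z)\<bar> \<partial>P)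
      \<le> of_nat (length ?N) * (ennreal (c * W) * ennreal ?A)"
  proof (rule integral_telescope_diff[THEN conjunct2, THEN conjunct2])
    fix w K assume wK: "(w, K) \<in> set ?N"
    then show "w < n \<and> \<bar>K\<bar> \<le> W"
      using arms_endpoints[OF Suc.prems(1) wK] arms_coupling[OF wK] Suc.prems(2,3) by auto
    fix h
    show "cavity k r ?R w (h(w := x)) = cavity k r ?R w h \<and> cavity k s ?R w (h(w := x)) = cavity k s ?R w h" for x
      using cavity_free[OF R(1)] by simp
    show "(\<lambda>z. cavity k r ?R w (field h z)) \<in> borel_measurable P \<and> (\<lambda>z. cavity k s ?R w (field h z)) \<in> borel_measurable P"
      using measurable_cavity_field[OF R] by simp
    show "(\<integral>\<^sup>+z. ennreal \<bar>cavity k r ?R w (field h z) - cavity k s ?R w (field h z)\<bar> \<partial>P) \<le> ennreal ?A"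
    proof (rule Suc.IH[OF R _ _ _ s(2)])
      show "\<bar>k e\<bar> \<le> W" if "e \<in> set ?R" for e using that Suc.prems(3) by (simp add: delete_node_def)
      show "length (filter (incident u) ?R) \<le> \<Delta>" for u using deg[of u] Suc.prems(4)[of u] by simp
      obtain e where e: "e \<in> set Es" "incident v e" "w = other v e" using wK by (auto simp: arms_def)
      then have "incident w e" by (auto simp: incident_def other_def split: if_splits)
      have "length (filter (incident w) ?R) < length (filter (incident w) Es)"
      proof -
        have "filter (incident w) ?R = filter (\<lambda>e. \<not> incident v e) (filter (incident w) Es)"
          by (simp add: delete_node_def conj_commute)
        moreover have "e \<in> set (filter (incident w) Es)" using e \<open>incident w e\<close> by simp
        ultimately show ?thesis using e(2) length_filter_less[of e "filter (incident w) Es"] by metis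
      qed
      then show "length (filter (incident w) ?R) \<le> \<Delta> - 1" using Suc.prems(4)[of w] by linarith
    qed
  qed
  also have "of_nat (length ?N) * (ennreal (c * W) * ennreal ?A) = ennreal (real (length ?N) * (c * W * ?A))"
    using assms(4,5) by (simp add: ennreal_mult ennreal_of_nat_eq_real_of_nat)
  also have "\<dots> \<le> ennreal (real m * (c * W * ?A))"
    using Suc.prems(5) assms(4,5) by (intro ennreal_leI mult_right_mono) (auto simp: arms_def)
  also have "real m * (c * W * ?A) = real m * W * (real (\<Delta> - 1) * c * W) ^ Suc r"
    by (simp add: algebra_simps)
  finally show ?case by (simp add: s(1))
qed

text \<open>
  The event that 0 lies between the two estimates of the bonus of \<open>v\<close>. Both contain the field of \<open>v\<close> as a
  summand that is independent of the rest, and the event confines it to an interval as long as the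
  difference of the estimates.
\<close>

lemma sign_error:
  assumes "loopless Es" "endpoints Es \<subseteq> {..<n}" "\<And>e. e \<in> set Es \<Longrightarrow> \<bar>k e\<bar> \<le> W" "0 \<le> W"
    and "\<And>u. length (filter (incident u) Es) \<le> \<Delta>" "r \<le> r'" and v: "v < n"
  shows "(\<integral>\<^sup>+z. indicator {z. min (field h z v + cavity k r Es v (field h z)) (field h z v + cavity k r' Es v (field h z)) \<le> 0 \<and>
      0 \<le> max (field h z v + cavity k r Es v (field h z)) (field h z v + cavity k r' Es v (field h z))} z \<partial>P) \<le>
    ennreal (c * (real \<Delta> * W * (real (\<Delta> - 1) * c * W) ^ r))"
proof -
  note [measurable] = measurable_cavity_field[OF assms(1,2), of k _ v h] measurable_field[OF v, of h]
  define f where "f = (\<lambda>z. indicator {z. min (field h z v + cavity k r Es v (field h z)) (field h z v + cavity k r' Es v (field h z)) \<le> 0 \<and>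
      0 \<le> max (field h z v + cavity k r Es v (field h z)) (field h z v + cavity k r' Es v (field h z))} z :: ennreal)"
  have "f \<in> borel_measurable P"
    unfolding f_def indicator_def by measurable
  then have "(\<integral>\<^sup>+z. f z \<partial>P) = (\<integral>\<^sup>+z. (\<integral>\<^sup>+y. f (z(\<nu> v := y)) \<partial>D (\<nu> v)) \<partial>P)"
    using v by (intro nn_integral_resample) auto
  also have "\<dots> \<le> (\<integral>\<^sup>+z. ennreal c * ennreal \<bar>cavity k r Es v (field h z) - cavity k r' Es v (field h z)\<bar> \<partial>P)"
  proof (rule nn_integral_mono)
    fix z
    let ?a = "h v + cavity k r Es v (field h z)" and ?b = "h v + cavity k r' Es v (field h z)"
    have "(\<integral>\<^sup>+y. f (z(\<nu> v := y)) \<partial>D (\<nu> v)) = (\<integral>\<^sup>+y. indicator {y. min (y + ?a) (y + ?b) \<le> 0 \<and> 0 \<le> max (y + ?a) (y + ?b)} y \<partial>D (\<nu> v))"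
      by (intro nn_integral_cong) (simp add: f_def indicator_def field_upd cavity_free[OF assms(1)] add_ac)
    also have "\<dots> \<le> ennreal (c * \<bar>?a - ?b\<bar>)"
      by (rule density_at_most_indicator[OF density_at_most[OF v]])
    also have "\<dots> = ennreal c * ennreal \<bar>cavity k r Es v (field h z) - cavity k r' Es v (field h z)\<bar>"
      using c_nonneg[OF v] by (simp add: ennreal_mult)
    finally show "(\<integral>\<^sup>+y. f (z(\<nu> v := y)) \<partial>D (\<nu> v)) \<le> \<dots>" .
  qed
  also have "\<dots> = ennreal c * (\<integral>\<^sup>+z. ennreal \<bar>cavity k r Es v (field h z) - cavity k r' Es v (field h z)\<bar> \<partial>P)"
    by (rule nn_integral_cmult) measurable
  also have "\<dots> \<le> ennreal c * ennreal (real \<Delta> * W * (real (\<Delta> - 1) * c * W) ^ r)"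
    by (intro mult_left_mono integral_cavity_diff assms c_nonneg[OF v]) auto
  also have "\<dots> = ennreal (c * (real \<Delta> * W * (real (\<Delta> - 1) * c * W) ^ r))"
    using c_nonneg[OF v] assms(4) by (simp add: ennreal_mult)
  finally show ?thesis by (simp add: f_def)
qed

end

section \<open>Binary networks with uniform parameters\<close>

text \<open>
  On \<open>{0, 1}\<close>, a function \<open>\<Phi>(a, b)\<close> equals
  \<open>\<Phi>(0, 0) + (\<Phi>(1, 0) - \<Phi>(0, 0)) * a + (\<Phi>(0, 1) - \<Phi>(0, 0)) * b + K * a * b\<close> with this coupling \<open>K\<close>; the
  linear terms are collected in \<open>edge_field\<close>.
\<close>

definition coupling :: "(param \<Rightarrow> real) \<Rightarrow> nat \<times> nat \<Rightarrow> real" where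
  "coupling y e = y (Edge e 1 1) - y (Edge e 1 0) - y (Edge e 0 1) + y (Edge e 0 0)"

definition edge_field :: "(param \<Rightarrow> real) \<Rightarrow> (nat \<times> nat) list \<Rightarrow> nat \<Rightarrow> real" where
  "edge_field y Es v =
    (\<Sum>e\<leftarrow>Es. (if fst e = v then y (Edge e 1 0) - y (Edge e 0 0) else 0) +
      (if snd e = v then y (Edge e 0 1) - y (Edge e 0 0) else 0))"

definition node_field :: "(param \<Rightarrow> real) \<Rightarrow> (nat \<times> nat) list \<Rightarrow> nat \<Rightarrow> real" where
  "node_field y Es v = y (Node v) + edge_field y Es v"

definition estimate :: "nat \<Rightarrow> (param \<Rightarrow> real) \<Rightarrow> (nat \<times> nat) list \<Rightarrow> nat \<Rightarrow> real" where
  "estimate r y Es v = node_field y Es v + cavity (coupling y) r Es v (node_field y Es)"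

lemma sum_list_edge_field:
  fixes f :: "nat \<Rightarrow> real"
  assumes "endpoints Es \<subseteq> {..<n}"
  shows "(\<Sum>v<n. edge_field y Es v * f v) =
    (\<Sum>e\<leftarrow>Es. (y (Edge e 1 0) - y (Edge e 0 0)) * f (fst e) + (y (Edge e 0 1) - y (Edge e 0 0)) * f (snd e))"
  using assms
proof (induction Es)
  case (Cons e Es)
  let ?g = "\<lambda>u d v. if u = v then d * f v else 0"
  have "(\<Sum>v<n. edge_field y (e # Es) v * f v) =
      (\<Sum>v<n. ?g (fst e) (y (Edge e 1 0) - y (Edge e 0 0)) v + ?g (snd e) (y (Edge e 0 1) - y (Edge e 0 0)) v
        + edge_field y Es v * f v)"
    by (intro sum.cong) (auto simp: edge_field_def algebra_simps)
  also have "\<dots> = (y (Edge e 1 0) - y (Edge e 0 0)) * f (fst e) + (y (Edge e 0 1) - y (Edge e 0 0)) * f (snd e)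
      + (\<Sum>v<n. edge_field y Es v * f v)"
    using Cons.prems by (simp add: sum.distrib endpoints_def)
  finally show ?case using Cons by (simp add: endpoints_def)
qed (simp add: edge_field_def)

lemma objective_qubo:
  assumes Es: "distinct Es" "set Es = E" "endpoints Es \<subseteq> {..<n}" and x: "x \<in> sols n"
  shows "objective (binary_network n E X \<omega>) x =
    ereal ((\<Sum>e\<leftarrow>Es. X (Edge e 0 0) \<omega>) +
      qubo n (node_field (\<lambda>i. X i \<omega>) Es) (coupling (\<lambda>i. X i \<omega>)) Es x)"
proof -
  define y where "y = (\<lambda>i. X i \<omega>)"
  have x2: "x v = 0 \<or> x v = 1" if "v < n" for v
    using PiE_mem[OF x, of v] that less_2_cases by fastforce
  have e: "y (Edge e (x (fst e)) (x (snd e))) = y (Edge e 0 0) +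
      ((y (Edge e 1 0) - y (Edge e 0 0)) * real (x (fst e)) + (y (Edge e 0 1) - y (Edge e 0 0)) * real (x (snd e))) +
      coupling y e * real (x (fst e)) * real (x (snd e))" if "e \<in> set Es" for e
  proof -
    have "fst e < n" "snd e < n" using that Es(3) by (auto simp: endpoints_def)
    then show ?thesis using x2[of "fst e"] x2[of "snd e"] by (auto simp: coupling_def)
  qed
  have "(\<Sum>(u, v)\<in>E. y (Edge (u, v) (x u) (x v))) = (\<Sum>e\<leftarrow>Es. y (Edge e (x (fst e)) (x (snd e))))"
    using Es(1) by (simp add: sum_list_distinct_conv_sum_set Es(2) split_def)
  also have "\<dots> = (\<Sum>e\<leftarrow>Es. y (Edge e 0 0) +
      ((y (Edge e 1 0) - y (Edge e 0 0)) * real (x (fst e)) + (y (Edge e 0 1) - y (Edge e 0 0)) * real (x (snd e))) +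
      coupling y e * real (x (fst e)) * real (x (snd e)))"
    using e by (intro arg_cong[where f = sum_list] map_cong) auto
  also have "\<dots> = (\<Sum>e\<leftarrow>Es. y (Edge e 0 0)) + (\<Sum>v<n. edge_field y Es v * real (x v)) +
      (\<Sum>e\<leftarrow>Es. coupling y e * real (x (fst e)) * real (x (snd e)))"
    by (simp add: sum_list_edge_field[OF Es(3)] sum_list_addf)
  finally have "(\<Sum>(u, v)\<in>E. y (Edge (u, v) (x u) (x v))) + (\<Sum>v<n. y (Node v) * real (x v)) =
      (\<Sum>e\<leftarrow>Es. y (Edge e 0 0)) + qubo n (node_field y Es) (coupling y) Es x"
    by (simp add: qubo_def node_field_def sum.distrib algebra_simps)
  moreover have "(\<Sum>v<n. y (Node v) * real (x v)) = (\<Sum>v<n. if x v = 0 then 0 else y (Node v))"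
  proof (rule sum.cong[OF refl])
    fix v assume "v \<in> {..<n}"
    then show "y (Node v) * real (x v) = (if x v = 0 then 0 else y (Node v))" using x2[of v] by auto
  qed
  ultimately have "(\<Sum>(u, v)\<in>E. y (Edge (u, v) (x u) (x v))) + (\<Sum>v<n. if x v = 0 then 0 else y (Node v)) =
      (\<Sum>e\<leftarrow>Es. y (Edge e 0 0)) + qubo n (node_field y Es) (coupling y) Es x" by simp
  from this[unfolded y_def] show ?thesis
    by (simp add: objective_def binary_network_def split_def)
qed

lemma solutions_binary_network: "solutions (binary_network n E X \<omega>) = sols n"
  by (simp add: solutions_def binary_network_def)

lemma optimum_qubo:
  assumes Es: "distinct Es" "set Es = E" "endpoints Es \<subseteq> {..<n}"
  shows "optimum (binary_network n E X \<omega>) =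
    ereal ((\<Sum>e\<leftarrow>Es. X (Edge e 0 0) \<omega>) +
      peak n (node_field (\<lambda>i. X i \<omega>) Es) (coupling (\<lambda>i. X i \<omega>)) Es)"
proof -
  let ?q = "\<lambda>x. (\<Sum>e\<leftarrow>Es. X (Edge e 0 0) \<omega>) + qubo n (node_field (\<lambda>i. X i \<omega>) Es) (coupling (\<lambda>i. X i \<omega>)) Es x"
  have ne: "sols n \<noteq> {}" using peak_attained[of n] by blast
  have "objective (binary_network n E X \<omega>) ` sols n = ereal ` ?q ` sols n"
    unfolding image_image by (rule image_cong[OF refl objective_qubo[OF Es]])
  moreover have "Max (ereal ` ?q ` sols n) = ereal (Max (?q ` sols n))"
    using finite_sols[of n] ne by (intro mono_Max_commute[symmetric]) (auto simp: mono_def)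
  moreover have "Max (?q ` sols n) = (\<Sum>e\<leftarrow>Es. X (Edge e 0 0) \<omega>) + peak n (node_field (\<lambda>i. X i \<omega>) Es) (coupling (\<lambda>i. X i \<omega>)) Es"
    unfolding peak_def using finite_sols[of n] ne by (rule Max_image_add) simp
  ultimately show ?thesis by (simp add: optimum_def solutions_binary_network)
qed

text \<open>
  The closed condition also covers a vanishing bonus, so that its negation separates both estimates from
  0 on the same side.
\<close>

definition straddle :: "real \<Rightarrow> real \<Rightarrow> bool" where
  "straddle a b \<longleftrightarrow> min a b \<le> 0 \<and> 0 \<le> max a b"

definition estimated_solution :: "nat \<Rightarrow> nat \<Rightarrow> (nat \<times> nat) list \<Rightarrow> (param \<Rightarrow> real) \<Rightarrow> nat \<Rightarrow> nat" where
  "estimated_solution r n Es y = (\<lambda>v\<in>{..<n}. if estimate r y Es v > 0 then 1 else 0)"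

lemma estimated_solution_mem: "estimated_solution r n Es y \<in> sols n"
  by (simp add: estimated_solution_def)

text \<open>
  At depth \<open>r' \<ge> length Es\<close> the estimate is the bonus itself.
\<close>

lemma estimated_solution_optimal:
  assumes Es: "distinct Es" "set Es = E" "endpoints Es \<subseteq> {..<n}" "loopless Es"
    and r': "length Es \<le> r'" and "\<And>v. v < n \<Longrightarrow> \<not> straddle (estimate r (\<lambda>i. X i \<omega>) Es v) (estimate r' (\<lambda>i. X i \<omega>) Es v)"
  shows "objective (binary_network n E X \<omega>) (estimated_solution r n Es (\<lambda>i. X i \<omega>)) = optimum (binary_network n E X \<omega>)"
proof -
  define y where "y = (\<lambda>i. X i \<omega>)"
  note sep = assms(6)[folded y_def]
  have b: "bonus n (node_field y Es) (coupling y) Es v = estimate r' y Es v" if "v < n" for v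
    unfolding estimate_def by (rule bonus_eq_cavity[OF Es(4,3) that r', symmetric])
  have nz: "bonus n (node_field y Es) (coupling y) Es v \<noteq> 0" if "v < n" for v
    using sep[OF that] b[OF that] by (auto simp: straddle_def)
  have "estimated_solution r n Es y = (\<lambda>v\<in>{..<n}. if bonus n (node_field y Es) (coupling y) Es v > 0 then 1 else 0)"
    unfolding estimated_solution_def
  proof (rule restrict_ext)
    fix v assume "v \<in> {..<n}"
    then show "(if estimate r y Es v > 0 then 1 else 0) = (if bonus n (node_field y Es) (coupling y) Es v > 0 then 1 else 0 :: nat)"
      using sep[of v] b[of v] by (auto simp: straddle_def)
  qed
  then have "qubo n (node_field y Es) (coupling y) Es (estimated_solution r n Es y) = peak n (node_field y Es) (coupling y) Es"
    by (simp only: sign_solution_optimal[OF nz])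
  then show ?thesis
    using objective_qubo[OF Es(1-3) estimated_solution_mem, of X \<omega> r Es y, folded y_def]
      optimum_qubo[OF Es(1-3), of X \<omega>, folded y_def]
    by (simp only: y_def)
qed

lemma estimate_cong:
  assumes "loopless Es" "endpoints Es \<subseteq> {..<n}" "v < n"
    and "\<And>u. u < n \<Longrightarrow> y (Node u) = y' (Node u)"
    and "\<And>e a b. e \<in> set Es \<Longrightarrow> a < 2 \<Longrightarrow> b < 2 \<Longrightarrow> y (Edge e a b) = y' (Edge e a b)"
  shows "estimate r y Es v = estimate r y' Es v"
proof -
  have "edge_field y Es u = edge_field y' Es u" for u
    unfolding edge_field_def using assms(5) by (intro arg_cong[where f = sum_list] map_cong) auto
  then have f: "node_field y Es u = node_field y' Es u" if "u < n" for u
    using assms(4)[OF that] by (simp add: node_field_def)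
  have "coupling y e = coupling y' e" if "e \<in> set Es" for e
    by (simp add: coupling_def assms(5)[OF that])
  then have "cavity (coupling y) r Es v (node_field y Es) = cavity (coupling y') r Es v (node_field y' Es)"
    using f assms(2) by (intro cavity_cong[OF assms(1)]) blast+
  then show ?thesis using f[OF assms(3)] by (simp add: estimate_def)
qed

lemma measurable_coupling:
  assumes "\<And>a b. a < 2 \<Longrightarrow> b < 2 \<Longrightarrow> (\<lambda>\<omega>. y \<omega> (Edge e a b)) \<in> borel_measurable Q"
  shows "(\<lambda>\<omega>. coupling (y \<omega>) e) \<in> borel_measurable Q"
  unfolding coupling_def by (intro borel_measurable_add borel_measurable_diff assms) simp_all

lemma measurable_node_field:
  assumes "(\<lambda>\<omega>. y \<omega> (Node v)) \<in> borel_measurable Q"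
    and "\<And>e a b. e \<in> set Es \<Longrightarrow> a < 2 \<Longrightarrow> b < 2 \<Longrightarrow> (\<lambda>\<omega>. y \<omega> (Edge e a b)) \<in> borel_measurable Q"
  shows "(\<lambda>\<omega>. node_field (y \<omega>) Es v) \<in> borel_measurable Q"
proof -
  have "(\<lambda>\<omega>. edge_field (y \<omega>) F v) \<in> borel_measurable Q" if "set F \<subseteq> set Es" for F
    using that
  proof (induction F)
    case (Cons e F)
    then have m: "(\<lambda>\<omega>. edge_field (y \<omega>) F v) \<in> borel_measurable Q"
      "(\<lambda>\<omega>. y \<omega> (Edge e 1 0)) \<in> borel_measurable Q" "(\<lambda>\<omega>. y \<omega> (Edge e 0 1)) \<in> borel_measurable Q"
      "(\<lambda>\<omega>. y \<omega> (Edge e 0 0)) \<in> borel_measurable Q"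
      by (simp_all add: assms(2))
    have "(\<lambda>\<omega>. ((if fst e = v then y \<omega> (Edge e 1 0) - y \<omega> (Edge e 0 0) else 0) +
      (if snd e = v then y \<omega> (Edge e 0 1) - y \<omega> (Edge e 0 0) else 0)) + edge_field (y \<omega>) F v) \<in> borel_measurable Q"
      by (cases "fst e = v"; cases "snd e = v"; simp only: if_True if_False simp_thms;
          intro borel_measurable_add borel_measurable_diff borel_measurable_const m)
    then show ?case by (simp add: edge_field_def)
  qed (simp add: edge_field_def)
  then show ?thesis
    unfolding node_field_def using assms(1) by (intro borel_measurable_add) simp_all
qed

lemma measurable_estimate:
  assumes "loopless Es" "endpoints Es \<subseteq> {..<n}" "v < n"
    and "\<And>u. u < n \<Longrightarrow> (\<lambda>\<omega>. y \<omega> (Node u)) \<in> borel_measurable Q"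
    and "\<And>e a b. e \<in> set Es \<Longrightarrow> a < 2 \<Longrightarrow> b < 2 \<Longrightarrow> (\<lambda>\<omega>. y \<omega> (Edge e a b)) \<in> borel_measurable Q"
  shows "(\<lambda>\<omega>. estimate r (y \<omega>) Es v) \<in> borel_measurable Q"
proof -
  have f: "(\<lambda>\<omega>. node_field (y \<omega>) Es u) \<in> borel_measurable Q" if "u < n" for u
    by (rule measurable_node_field[OF assms(4)[OF that] assms(5)])
  have "(\<lambda>\<omega>. cavity (coupling (y \<omega>)) r Es v (node_field (y \<omega>) Es)) \<in> borel_measurable Q"
  proof (rule measurable_cavity[OF assms(1)])
    show "(\<lambda>\<omega>. coupling (y \<omega>) e) \<in> borel_measurable Q" if "e \<in> set Es" for e
      by (rule measurable_coupling) (rule assms(5)[OF that])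
    show "\<forall>u\<in>endpoints Es - {v}. (\<lambda>\<omega>. node_field (y \<omega>) Es u) \<in> borel_measurable Q"
      using f assms(2) by blast
  qed
  then show ?thesis unfolding estimate_def by (rule borel_measurable_add[OF f[OF assms(3)]])
qed

lemma uniform_on_distr:
  assumes "uniform_on M X r" "0 < r"
  shows "X \<in> borel_measurable M"
    and "distr M borel X = density lborel (\<lambda>x. ennreal (indicator {-r..r} x / (2 * r)))"
proof -
  have m: "measure lborel {-r..r} = 2 * r" using assms(2) by simp
  show "X \<in> borel_measurable M" using assms(1) by (simp add: uniform_on_def distributed_def)
  have "distr M borel X = distr M lborel X" by (rule distr_cong) auto
  also have "\<dots> = density lborel (\<lambda>x. ennreal (indicator {-r..r} x / (2 * r)))"
    using assms(1) unfolding uniform_on_def distributed_def m by blast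
  finally show "distr M borel X = density lborel (\<lambda>x. ennreal (indicator {-r..r} x / (2 * r)))" .
qed

lemma uniform_on_density_at_most:
  assumes "prob_space M" "uniform_on M X r" "0 < r"
  shows "density_at_most (1 / (2 * r)) (distr M borel X)"
  unfolding density_at_most_def
proof (intro conjI ballI)
  show "prob_space (distr M borel X)"
    using assms(1) uniform_on_distr[OF assms(2,3)] by (intro prob_space.prob_space_distr) auto
  fix f :: "real \<Rightarrow> ennreal" assume [measurable]: "f \<in> borel_measurable borel"
  have "(\<integral>\<^sup>+x. f x \<partial>distr M borel X) = (\<integral>\<^sup>+x. ennreal (indicator {-r..r} x / (2 * r)) * f x \<partial>lborel)"
    unfolding uniform_on_distr(2)[OF assms(2,3)] by (rule nn_integral_density) measurable
  also have "\<dots> \<le> (\<integral>\<^sup>+x. ennreal (1 / (2 * r)) * f x \<partial>lborel)"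
    using assms(3) by (intro nn_integral_mono mult_right_mono ennreal_leI) (auto simp: indicator_def)
  also have "\<dots> = ennreal (1 / (2 * r)) * (\<integral>\<^sup>+x. f x \<partial>lborel)"
    by (rule nn_integral_cmult) measurable
  finally show "(\<integral>\<^sup>+x. f x \<partial>distr M borel X) \<le> ennreal (1 / (2 * r)) * (\<integral>\<^sup>+x. f x \<partial>lborel)" .
qed (use assms(3) in auto)

lemma uniform_on_AE_bounded:
  assumes "uniform_on M X r" "0 < r"
  shows "AE \<omega> in M. \<bar>X \<omega>\<bar> \<le> r"
proof -
  have "AE x in distr M borel X. \<bar>x\<bar> \<le> r"
    unfolding uniform_on_distr(2)[OF assms] by (subst AE_density) (auto simp: indicator_def)
  then show ?thesis
    using uniform_on_distr(1)[OF assms] by (subst (asm) AE_distr_iff) auto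
qed

text \<open>
  The parameters of the edges and of the nodes are the two factors of a product measure. For fixed edge
  parameters of absolute value at most \<open>I2\<close>, the node parameters form random fields with densities
  bounded by \<open>1 / (2 * I1)\<close>, and \<open>sign_error\<close> bounds the inner integral. Other edge parameters have
  probability 0 and are excluded from the event beforehand.
\<close>

lemma prob_straddle:
  fixes X :: "param \<Rightarrow> 'w \<Rightarrow> real"
  assumes M: "prob_space M" and I: "0 < I1" "0 < I2"
    and Es: "loopless Es" "endpoints Es \<subseteq> {..<n}" "\<And>u. length (filter (incident u) Es) \<le> \<Delta>"
    and nodes: "\<And>u. u < n \<Longrightarrow> uniform_on M (X (Node u)) I1"
    and edges: "\<And>e a b. e \<in> set Es \<Longrightarrow> a < 2 \<Longrightarrow> b < 2 \<Longrightarrow> uniform_on M (X (Edge e a b)) I2"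
    and indep: "prob_space.indep_vars M (\<lambda>_. borel) X
          ({Node u | u. u < n} \<union> {Edge e a b | e a b. e \<in> set Es \<and> a < 2 \<and> b < 2})"
    and r: "r \<le> r'" and v: "v < n"
  shows "measure M {\<omega> \<in> space M. straddle (estimate r (\<lambda>i. X i \<omega>) Es v) (estimate r' (\<lambda>i. X i \<omega>) Es v)} \<le>
    2 * real \<Delta> * I2 / I1 * (2 * real (\<Delta> - 1) * I2 / I1) ^ r"
proof -
  interpret M: prob_space M by (rule M)
  define Kn where "Kn = Node ` {..<n}"
  define Ke where "Ke = {Edge e a b | e a b. e \<in> set Es \<and> a < 2 \<and> b < 2}"
  define K where "K = Ke \<union> Kn"
  have Kn_eq: "{Node u | u. u < n} = Kn" by (auto simp: Kn_def)
  have Ke: "Edge e a b \<in> Ke" "Edge e a b \<in> K" if "e \<in> set Es" "a < 2" "b < 2" for e a b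
    using that unfolding Ke_def K_def by blast+
  have Kn: "Node u \<in> K" if "u < n" for u using that by (simp add: K_def Kn_def)
  have Ke_elim: "\<exists>e a b. i = Edge e a b \<and> e \<in> set Es \<and> a < 2 \<and> b < 2" if "i \<in> Ke" for i
    using that unfolding Ke_def by blast
  have "Ke \<subseteq> (\<lambda>(e, a, b). Edge e a b) ` (set Es \<times> {..<2} \<times> {..<2})"
  proof
    fix i assume "i \<in> Ke"
    then obtain e a b where "i = Edge e a b" "e \<in> set Es" "a < 2" "b < 2" using Ke_elim by blast
    then show "i \<in> (\<lambda>(e, a, b). Edge e a b) ` (set Es \<times> {..<2} \<times> {..<2})"
      by (intro image_eqI[of _ _ "(e, a, b)"]) auto
  qed
  then have "finite Ke" by (rule finite_subset) simp
  moreover have "Node u \<notin> Ke" for u using Ke_elim[of "Node u"] by blast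
  ultimately have fin: "finite Kn" "finite Ke" "Ke \<inter> Kn = {}" by (auto simp: Kn_def)
  have mK: "X i \<in> borel_measurable M" if "i \<in> K" for i
  proof (cases i)
    case (Node u)
    then have "u < n" using that Ke_elim[of i] by (auto simp: K_def Kn_def)
    then show ?thesis using uniform_on_distr(1)[OF nodes I(1)] Node by simp
  next
    case (Edge e a b)
    then have "e \<in> set Es" "a < 2" "b < 2" using that Ke_elim[of i] by (auto simp: K_def Kn_def)
    then show ?thesis using uniform_on_distr(1)[OF edges I(2)] Edge by simp
  qed
  \<comment> \<open>Outside \<open>K\<close>, \<open>X\<close> need not be measurable; a point mass keeps every factor a probability space.\<close>
  define D where "D = (\<lambda>i. if i \<in> K then distr M borel (X i) else return borel 0)"
  have D_sets: "sets (D i) = sets borel" for i by (simp add: D_def)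
  have D_prob: "prob_space (D i)" for i
    using mK by (auto simp: D_def intro: M.prob_space_distr prob_space_return)
  interpret D: product_prob_space D "Node ` {..<n}"
    using D_prob by (intro product_prob_spaceI)
  interpret F: random_fields D Node n "1 / (2 * I1)"
    by unfold_locales
      (auto simp: inj_def D_def Kn intro: uniform_on_density_at_most[OF M nodes I(1)])
  define f :: "(param \<Rightarrow> real) \<Rightarrow> ennreal" where
    "f = (\<lambda>y. indicator {y. (\<forall>i\<in>Ke. \<bar>y i\<bar> \<le> I2) \<and> straddle (estimate r y Es v) (estimate r' y Es v)} y)"
  have comp: "(\<lambda>y. y i) \<in> borel_measurable (PiM K (\<lambda>_. borel :: real measure))" if "i \<in> K" for i
    using that by (rule measurable_component_singleton)
  have [measurable]: "(\<lambda>y. estimate s y Es v) \<in> borel_measurable (PiM K (\<lambda>_. borel))" for s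
    using Es(1,2) v by (rule measurable_estimate) (rule comp[OF Kn] comp[OF Ke(2)], assumption+)+
  have [measurable]: "f \<in> borel_measurable (PiM K (\<lambda>_. borel))"
  proof -
    have [measurable]: "Measurable.pred (PiM K (\<lambda>_. borel)) (\<lambda>y. \<forall>i\<in>Ke. \<bar>y i\<bar> \<le> I2)"
    proof (rule pred_intros_finite(3)[OF fin(2)])
      fix i assume "i \<in> Ke"
      then have [measurable]: "(\<lambda>y. y i) \<in> borel_measurable (PiM K (\<lambda>_. borel :: real measure))"
        by (intro comp) (simp add: K_def)
      show "Measurable.pred (PiM K (\<lambda>_. borel)) (\<lambda>y. \<bar>y i\<bar> \<le> I2)" by measurable
    qed
    show ?thesis unfolding f_def straddle_def indicator_def by measurable
  qed
  have setsD: "sets (PiM K D) = sets (PiM K (\<lambda>_. borel))"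
    by (rule sets_PiM_cong) (auto simp: D_sets)
  have fD: "f \<in> borel_measurable (PiM (Ke \<union> Kn) D)"
    using \<open>f \<in> borel_measurable (PiM K (\<lambda>_. borel))\<close> measurable_cong_sets[OF setsD refl, of borel]
    unfolding K_def by blast
  have rv: "(\<lambda>\<omega>. \<lambda>i\<in>K. X i \<omega>) \<in> measurable M (PiM K (\<lambda>_. borel))"
    using mK by (intro measurable_restrict)
  have law: "distr M (PiM K (\<lambda>_. borel)) (\<lambda>\<omega>. \<lambda>i\<in>K. X i \<omega>) = PiM (Ke \<union> Kn) D"
  proof -
    have "K \<noteq> {}" using v by (auto simp: K_def Kn_def)
    moreover have "M.indep_vars (\<lambda>_. borel) X K"
      using indep unfolding Kn_eq Ke_def[symmetric] K_def by (simp only: Un_commute)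
    ultimately have "distr M (PiM K (\<lambda>_. borel)) (\<lambda>\<omega>. \<lambda>i\<in>K. X i \<omega>) = PiM K (\<lambda>i. distr M borel (X i))"
      using M.indep_vars_iff_distr_eq_PiM'[where I = K and M' = "\<lambda>_. borel" and X = X] mK by simp
    also have "\<dots> = PiM K D" by (rule PiM_cong) (auto simp: D_def)
    finally show ?thesis by (simp add: K_def)
  qed
  let ?S = "{\<omega> \<in> space M. straddle (estimate r (\<lambda>i. X i \<omega>) Es v) (estimate r' (\<lambda>i. X i \<omega>) Es v)}"
  have [measurable]: "(\<lambda>\<omega>. estimate s (\<lambda>i. X i \<omega>) Es v) \<in> borel_measurable M" for s
    using Es(1,2) v by (rule measurable_estimate) (rule mK[OF Kn] mK[OF Ke(2)], assumption+)+
  have S: "?S \<in> sets M" unfolding straddle_def by measurable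
  define bnd where "bnd = 2 * real \<Delta> * I2 / I1 * (2 * real (\<Delta> - 1) * I2 / I1) ^ r"
  have bnd: "bnd = 1 / (2 * I1) * (real \<Delta> * (4 * I2) * (real (\<Delta> - 1) * (1 / (2 * I1)) * (4 * I2)) ^ r)"
  proof -
    have "real (\<Delta> - 1) * (1 / (2 * I1)) * (4 * I2) = 2 * real (\<Delta> - 1) * I2 / I1"
      using I by (simp add: field_simps)
    moreover have "2 * real \<Delta> * I2 / I1 * t = 1 / (2 * I1) * (real \<Delta> * (4 * I2) * t)" for t
      using I by (simp add: field_simps)
    ultimately show ?thesis by (simp only: bnd_def)
  qed
  have "AE \<omega> in M. \<forall>i\<in>Ke. \<bar>X i \<omega>\<bar> \<le> I2"
  proof (rule AE_finite_allI[OF fin(2)])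
    fix i assume "i \<in> Ke"
    then obtain e a b where "i = Edge e a b" "e \<in> set Es" "a < 2" "b < 2" using Ke_elim by blast
    then show "AE \<omega> in M. \<bar>X i \<omega>\<bar> \<le> I2" using uniform_on_AE_bounded[OF edges I(2)] by simp
  qed
  then have AE: "AE \<omega> in M. indicator ?S \<omega> \<le> f (\<lambda>i\<in>K. X i \<omega>)"
  proof eventually_elim
    case (elim \<omega>)
    have "estimate s (\<lambda>i\<in>K. X i \<omega>) Es v = estimate s (\<lambda>i. X i \<omega>) Es v" for s
      using Es(1,2) v by (rule estimate_cong) (simp_all add: Ke Kn)
    moreover have "\<forall>i\<in>Ke. \<bar>(\<lambda>i\<in>K. X i \<omega>) i\<bar> \<le> I2" using elim by (simp add: K_def)
    ultimately show ?case by (simp add: f_def indicator_def)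
  qed
  have "emeasure M ?S = (\<integral>\<^sup>+\<omega>. indicator ?S \<omega> \<partial>M)" using S by simp
  also have "\<dots> \<le> (\<integral>\<^sup>+\<omega>. f (\<lambda>i\<in>K. X i \<omega>) \<partial>M)"
    using AE by (rule nn_integral_mono_AE)
  also have "\<dots> = (\<integral>\<^sup>+y. f y \<partial>distr M (PiM K (\<lambda>_. borel)) (\<lambda>\<omega>. \<lambda>i\<in>K. X i \<omega>))"
    by (rule nn_integral_distr[symmetric, OF rv]) measurable
  also have "\<dots> = (\<integral>\<^sup>+x. (\<integral>\<^sup>+z. f (merge Ke Kn (x, z)) \<partial>PiM Kn D) \<partial>PiM Ke D)"
    unfolding law using fin fD by (intro D.product_nn_integral_fold) auto
  also have "\<dots> \<le> (\<integral>\<^sup>+x. ennreal bnd \<partial>PiM Ke D)"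
  proof (rule nn_integral_mono)
    fix x
    show "(\<integral>\<^sup>+z. f (merge Ke Kn (x, z)) \<partial>PiM Kn D) \<le> ennreal bnd"
    proof (cases "\<forall>i\<in>Ke. \<bar>x i\<bar> \<le> I2")
      case True
      have k: "\<bar>coupling x e\<bar> \<le> 4 * I2" if "e \<in> set Es" for e
      proof -
        have "\<bar>x (Edge e a b)\<bar> \<le> I2" if "a < 2" "b < 2" for a b
          using True Ke(1)[OF \<open>e \<in> set Es\<close> that] by blast
        from this[of 0 0] this[of 0 1] this[of 1 0] this[of 1 1] show ?thesis
          unfolding coupling_def by simp
      qed
      have est: "estimate s (merge Ke Kn (x, z)) Es v =
        F.field (edge_field x Es) z v + cavity (coupling x) s Es v (F.field (edge_field x Es) z)" for s z
      proof -
        define y where "y = (\<lambda>i. case i of Node u \<Rightarrow> z i | Edge e a b \<Rightarrow> x i)"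
        have y: "y (Edge e a b) = x (Edge e a b)" "y (Node u) = z (Node u)" for e a b u
          by (simp_all add: y_def)
        have "estimate s (merge Ke Kn (x, z)) Es v = estimate s y Es v"
          using Es(1,2) v by (rule estimate_cong) (simp_all add: merge_def y Ke, auto simp: Kn_def dest: Ke_elim)
        moreover have "node_field y Es = F.field (edge_field x Es) z"
          unfolding node_field_def F.field_def edge_field_def y fun_eq_iff by (intro allI add.commute)
        moreover have "coupling y = coupling x" by (simp add: coupling_def y fun_eq_iff)
        ultimately show ?thesis by (simp add: estimate_def)
      qed
      have "(\<integral>\<^sup>+z. f (merge Ke Kn (x, z)) \<partial>PiM Kn D) \<le>
        (\<integral>\<^sup>+z. indicator {z. min (F.field (edge_field x Es) z v + cavity (coupling x) r Es v (F.field (edge_field x Es) z))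
            (F.field (edge_field x Es) z v + cavity (coupling x) r' Es v (F.field (edge_field x Es) z)) \<le> 0 \<and>
          0 \<le> max (F.field (edge_field x Es) z v + cavity (coupling x) r Es v (F.field (edge_field x Es) z))
            (F.field (edge_field x Es) z v + cavity (coupling x) r' Es v (F.field (edge_field x Es) z))} z \<partial>PiM Kn D)"
        by (rule nn_integral_mono) (simp add: f_def straddle_def indicator_def est)
      also have "\<dots> \<le> ennreal bnd"
        unfolding bnd Kn_def using I by (intro F.sign_error Es k r v) simp_all
      finally show ?thesis .
    next
      case False
      then have "f (merge Ke Kn (x, z)) = 0" for z
        using fin(3) by (auto simp: f_def merge_def)
      then show ?thesis by simp
    qed
  qed
  also have "\<dots> = ennreal bnd"
  proof -
    interpret E: product_prob_space D Ke using D_prob by (intro product_prob_spaceI)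
    show ?thesis by (simp add: E.emeasure_space_1)
  qed
  finally have "emeasure M ?S \<le> ennreal bnd" .
  moreover have "0 \<le> bnd" using I by (simp add: bnd_def)
  ultimately show ?thesis
    unfolding bnd_def[symmetric] by (simp add: M.emeasure_eq_measure)
qed

section \<open>Evaluation of programs by rewriting\<close>

definition tick :: "nat \<Rightarrow> (val \<times> nat) option \<Rightarrow> (val \<times> nat) option" where
  "tick s r = map_option (\<lambda>(v, t). (v, s + t + 1)) r"

lemma tick_simps [simp]:
  "tick s None = None"
  "tick s (Some (v, t)) = Some (v, s + t + 1)"
  by (simp_all add: tick_def)

lemma tick_eq_Some: "tick s r = Some (v, t) \<longleftrightarrow> (\<exists>u. r = Some (v, u) \<and> t = s + u + 1)"
  by (auto simp: tick_def)

text \<open>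
  The evaluation relation as a function, structurally recursive because calls are answered by an oracle
  \<open>\<phi>\<close>. With the program's own input-output behaviour as \<open>\<phi>\<close> (\<open>run\<close>), one unfolding of a function body
  suffices to determine the value and time of a call from those of its recursive calls.
\<close>

fun interp :: "(nat \<Rightarrow> val list \<Rightarrow> (val \<times> nat) option) \<Rightarrow> val list \<Rightarrow> expr \<Rightarrow> (val \<times> nat) option"
  and interps :: "(nat \<Rightarrow> val list \<Rightarrow> (val \<times> nat) option) \<Rightarrow> val list \<Rightarrow> expr list \<Rightarrow> (val list \<times> nat) option"
where
  "interp \<phi> env (Var i) = (if i < length env then Some (env ! i, 1) else None)"
| "interp \<phi> env (Const c) = Some (Num (real_of_int c), 1)"
| "interp \<phi> env (Add e1 e2) = (case interp \<phi> env e1 of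
      Some (Num x, s) \<Rightarrow> (case interp \<phi> env e2 of Some (Num y, t) \<Rightarrow> Some (Num (x + y), s + t + 1) | _ \<Rightarrow> None)
    | _ \<Rightarrow> None)"
| "interp \<phi> env (Sub e1 e2) = (case interp \<phi> env e1 of
      Some (Num x, s) \<Rightarrow> (case interp \<phi> env e2 of Some (Num y, t) \<Rightarrow> Some (Num (x - y), s + t + 1) | _ \<Rightarrow> None)
    | _ \<Rightarrow> None)"
| "interp \<phi> env (If_le e1 e2 e3 e4) = (case interp \<phi> env e1 of
      Some (Num x, s) \<Rightarrow> (case interp \<phi> env e2 of
          Some (Num y, t) \<Rightarrow> tick (s + t) (if x \<le> y then interp \<phi> env e3 else interp \<phi> env e4)
        | _ \<Rightarrow> None)
    | _ \<Rightarrow> None)"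
| "interp \<phi> env Null_exp = Some (Null, 1)"
| "interp \<phi> env (Cell_exp e1 e2) = (case interp \<phi> env e1 of
      Some (v, s) \<Rightarrow> (case interp \<phi> env e2 of Some (w, t) \<Rightarrow> Some (Cell v w, s + t + 1) | None \<Rightarrow> None)
    | None \<Rightarrow> None)"
| "interp \<phi> env (Case_exp e e1 e2 e3) = (case interp \<phi> env e of
      Some (Num x, s) \<Rightarrow> tick s (interp \<phi> env e1)
    | Some (Null, s) \<Rightarrow> tick s (interp \<phi> env e2)
    | Some (Cell a b, s) \<Rightarrow> tick s (interp \<phi> (a # b # env) e3)
    | None \<Rightarrow> None)"
| "interp \<phi> env (Let_exp e1 e2) = (case interp \<phi> env e1 of
      Some (v, s) \<Rightarrow> tick s (interp \<phi> (v # env) e2)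
    | None \<Rightarrow> None)"
| "interp \<phi> env (Call f es) = (case interps \<phi> env es of
      Some (vs, s) \<Rightarrow> tick s (\<phi> f vs)
    | None \<Rightarrow> None)"
| "interps \<phi> env [] = Some ([], 0)"
| "interps \<phi> env (e # es) = (case interp \<phi> env e of
      Some (v, s) \<Rightarrow> (case interps \<phi> env es of Some (vs, t) \<Rightarrow> Some (v # vs, s + t) | None \<Rightarrow> None)
    | None \<Rightarrow> None)"

lemmas eval_intros = eval_evals.intros[unfolded One_nat_def add_Suc_right add_0_right]

lemma interps_sound:
  assumes "\<And>e v t. e \<in> set es \<Longrightarrow> interp \<phi> env e = Some (v, t) \<Longrightarrow> eval P env e v t"
  shows "interps \<phi> env es = Some (vs, s) \<Longrightarrow> evals P env es vs s"
  using assms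
  by (induction es arbitrary: vs s) (auto split: option.splits intro: eval_intros(14), blast intro: eval_intros(15))

lemma interp_sound:
  assumes "\<And>f vs v t. \<phi> f vs = Some (v, t) \<Longrightarrow> f < length P \<and> eval P vs (P ! f) v t"
  shows "interp \<phi> env e = Some (v, t) \<Longrightarrow> eval P env e v t"
proof (induction e arbitrary: env v t)
  case (Call f es)
  from Call.prems obtain vs s u where "interps \<phi> env es = Some (vs, s)" "\<phi> f vs = Some (v, u)" "t = s + u + 1"
    by (auto simp: tick_eq_Some split: option.splits)
  moreover from this(1) have "evals P env es vs s" by (rule interps_sound[rotated]) (rule Call.IH)
  ultimately show ?case using assms[of f vs v u] eval_evals.Call[of f P env es vs s v u] by simp
qed (auto simp: tick_eq_Some split: option.splits val.splits if_splits intro: eval_intros(1,2,7),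
    (blast intro: eval_intros)+)

definition run :: "expr list \<Rightarrow> nat \<Rightarrow> val list \<Rightarrow> (val \<times> nat) option" where
  "run P f vs = (if f < length P \<and> (\<exists>v t. eval P vs (P ! f) v t)
    then Some (SOME (v, t). eval P vs (P ! f) v t) else None)"

lemma run_sound: "run P f vs = Some (v, t) \<Longrightarrow> f < length P \<and> eval P vs (P ! f) v t"
proof -
  assume r: "run P f vs = Some (v, t)"
  then have f: "f < length P" and ex: "\<exists>v t. eval P vs (P ! f) v t"
    and vt: "(v, t) = (SOME (v, t). eval P vs (P ! f) v t)"
    by (auto simp: run_def split: if_splits)
  from ex have "\<exists>p. case p of (v, t) \<Rightarrow> eval P vs (P ! f) v t" by auto
  then have "case (SOME (v, t). eval P vs (P ! f) v t) of (v, t) \<Rightarrow> eval P vs (P ! f) v t"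
    by (rule someI_ex)
  with f vt show ?thesis by (metis case_prodD)
qed

lemma run_eq:
  assumes "f < length P" "interp (run P) vs (P ! f) = Some (v, t)"
  shows "run P f vs = Some (v, t)"
proof -
  have ev: "eval P vs (P ! f) v t" using assms(2) run_sound by (intro interp_sound) auto
  then obtain v' t' where "run P f vs = Some (v', t')"
    using assms(1) by (auto simp: run_def split: prod.splits) (metis surj_pair)
  with run_sound[OF this] eval_deterministic(1)[OF ev] show ?thesis by auto
qed

text \<open>
  A result together with a time bound \<open>B\<close>, so that induction need not track exact times.
\<close>

definition yields :: "nat \<Rightarrow> val \<Rightarrow> (val \<times> nat) option \<Rightarrow> bool" where
  "yields B v r \<longleftrightarrow> (\<exists>t\<le>B. r = Some (v, t))"

lemma yields_Some [simp]: "yields B v (Some (w, t)) \<longleftrightarrow> w = v \<and> t \<le> B"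
  by (auto simp: yields_def)

lemma yieldsE: "yields B v r \<Longrightarrow> (\<And>t. r = Some (v, t) \<Longrightarrow> t \<le> B \<Longrightarrow> thesis) \<Longrightarrow> thesis"
  by (auto simp: yields_def)

lemma yields_runI: "f < length P \<Longrightarrow> yields B v (interp (run P) vs (P ! f)) \<Longrightarrow> yields B v (run P f vs)"
  by (auto simp: yields_def run_eq)

section \<open>The program\<close>

text \<open>
  A network in normal form is kept as a list of fields, in which several entries for one node are added
  up, and a list of edges with couplings. Raising a field is then the construction of one cell. Recursive
  calls precede the tests on the head of a list, which makes all branches cheap.
\<close>

abbreviation (input) LOOKUP :: nat where "LOOKUP \<equiv> 0"
abbreviation (input) ARMS :: nat where "ARMS \<equiv> 1"
abbreviation (input) DELETE_NODE :: nat where "DELETE_NODE \<equiv> 2"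
abbreviation (input) CAVITY :: nat where "CAVITY \<equiv> 3"
abbreviation (input) TELESCOPE :: nat where "TELESCOPE \<equiv> 4"
abbreviation (input) DEPTH :: nat where "DEPTH \<equiv> 5"
abbreviation (input) SOLUTION :: nat where "SOLUTION \<equiv> 6"
abbreviation (input) FIELDS :: nat where "FIELDS \<equiv> 7"
abbreviation (input) EDGE_FIELDS :: nat where "EDGE_FIELDS \<equiv> 8"
abbreviation (input) COUPLINGS :: nat where "COUPLINGS \<equiv> 9"

abbreviation If_eq :: "expr \<Rightarrow> expr \<Rightarrow> expr \<Rightarrow> expr \<Rightarrow> expr" where
  "If_eq a b e1 e2 \<equiv> If_le a b (If_le b a e1 e2) e2"

text \<open>
  Inspection of a list or of a pair; the first branch is the empty list, or an ill-typed value that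
  does not occur.
\<close>

abbreviation Uncons :: "expr \<Rightarrow> expr \<Rightarrow> expr \<Rightarrow> expr" where
  "Uncons e e0 e1 \<equiv> Case_exp e e0 e0 e1"

abbreviation Pos :: "nat \<Rightarrow> expr" where
  "Pos i \<equiv> If_le (Var i) (Const 0) (Const 0) (Var i)"

definition lookup_body :: expr where
  "lookup_body =
    Uncons (Var 1) (Const 0)
      (Let_exp (Call LOOKUP [Var 2, Var 1])
        (Uncons (Var 1) (Const 0)
          (If_eq (Var 0) (Var 5) (Add (Var 1) (Var 2)) (Var 2))))"

definition arms_body :: expr where
  "arms_body =
    Uncons (Var 1) Null_exp
      (Let_exp (Call ARMS [Var 2, Var 1])
        (Uncons (Var 1) Null_exp
          (Uncons (Var 1) Null_exp
            (If_eq (Var 2) (Var 7) (Cell_exp (Cell_exp (Var 0) (Var 1)) (Var 4))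
              (If_eq (Var 0) (Var 7) (Cell_exp (Cell_exp (Var 2) (Var 1)) (Var 4)) (Var 4))))))"

definition delete_node_body :: expr where
  "delete_node_body =
    Uncons (Var 1) Null_exp
      (Let_exp (Call DELETE_NODE [Var 2, Var 1])
        (Uncons (Var 1) Null_exp
          (Uncons (Var 1) Null_exp
            (If_eq (Var 2) (Var 7) (Var 4)
              (If_eq (Var 0) (Var 7) (Var 4) (Cell_exp (Var 5) (Var 4)))))))"

definition cavity_body :: expr where
  "cavity_body =
    Uncons (Var 0) (Const 0)
      (Call TELESCOPE [Var 1, Call ARMS [Var 3, Var 5], Var 4, Call DELETE_NODE [Var 3, Var 5]])"

definition telescope_body :: expr where
  "telescope_body =
    Uncons (Var 1) (Const 0)
      (Uncons (Var 0) (Const 0)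
        (Let_exp (Add (Call LOOKUP [Var 0, Var 6]) (Call CAVITY [Var 4, Var 0, Var 6, Var 7]))
          (Let_exp (Add (Var 0) (Var 2))
            (Add (Sub (Pos 0) (Pos 1)) (Call TELESCOPE [Var 6, Var 5, Cell_exp (Var 4) (Var 8), Var 9])))))"

text \<open>
  Doubles \<open>\<epsilon>\<close> until it reaches a given number and returns a unary counter, four units for each doubling,
  since \<open>(4 / 5) ^ 4 < 1 / 2\<close>.
\<close>

definition depth_body :: expr where
  "depth_body =
    If_le (Var 1) (Var 0) Null_exp
      (Let_exp (Call DEPTH [Add (Var 0) (Var 0), Var 1])
        (Cell_exp Null_exp (Cell_exp Null_exp (Cell_exp Null_exp (Cell_exp Null_exp (Var 0))))))"

definition solution_body :: expr where
  "solution_body =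
    If_le (Var 1) (Var 0) Null_exp
      (Cell_exp
        (If_le (Add (Call LOOKUP [Var 0, Var 3]) (Call CAVITY [Var 2, Var 0, Var 3, Var 4])) (Const 0)
          (Const 0) (Const 1))
        (Call SOLUTION [Add (Const 1) (Var 0), Var 1, Var 2, Var 3, Var 4]))"

definition fields_body :: expr where
  "fields_body =
    Uncons (Var 1) (Var 2)
      (Cell_exp
        (Cell_exp (Var 2) (Uncons (Var 0) (Const 0) (Uncons (Var 1) (Const 0) (Var 0))))
        (Call FIELDS [Add (Const 1) (Var 2), Var 1, Var 4]))"

text \<open>
  Takes apart the first edge of the input. In \<open>e\<close>, its nodes are the variables 14 and 12, the
  interactions for \<open>(0, 0)\<close>, \<open>(0, 1)\<close>, \<open>(1, 0)\<close>, \<open>(1, 1)\<close> are 8, 6, 2, 0, and the remaining edges are 17.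
\<close>

definition Uncons_edge :: "expr \<Rightarrow> expr" where
  "Uncons_edge e =
    Uncons (Var 0) Null_exp (Uncons (Var 0) Null_exp (Uncons (Var 1) Null_exp
      (Uncons (Var 1) Null_exp (Uncons (Var 0) Null_exp (Uncons (Var 1) Null_exp
        (Uncons (Var 5) Null_exp (Uncons (Var 0) Null_exp (Uncons (Var 1) Null_exp e))))))))"

definition edge_fields_body :: expr where
  "edge_fields_body = Uncons_edge
    (Cell_exp (Cell_exp (Var 14) (Sub (Var 2) (Var 8)))
      (Cell_exp (Cell_exp (Var 12) (Sub (Var 6) (Var 8)))
        (Call EDGE_FIELDS [Var 17])))"

definition couplings_body :: expr where
  "couplings_body = Uncons_edge
    (Cell_exp (Cell_exp (Var 14) (Cell_exp (Var 12) (Add (Sub (Sub (Var 0) (Var 2)) (Var 6)) (Var 8))))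
      (Call COUPLINGS [Var 17]))"

definition prog :: "expr list" where
  "prog = [lookup_body, arms_body, delete_node_body, cavity_body, telescope_body, depth_body, solution_body,
    fields_body, edge_fields_body, couplings_body]"

fun multiple :: "nat \<Rightarrow> expr \<Rightarrow> expr" where
  "multiple 0 e = Const 0"
| "multiple (Suc c) e = Add e (multiple c e)"

definition main_exp :: "nat \<Rightarrow> expr" where
  "main_exp C = Uncons (Var 1) Null_exp (Uncons (Var 1) Null_exp (Uncons (Var 1) Null_exp
    (Call SOLUTION [Const 0, Var 4, Call DEPTH [Var 6, multiple C (Var 4)],
      Call FIELDS [Const 0, Var 0, Call EDGE_FIELDS [Var 1]], Call COUPLINGS [Var 1]])))"

lemma prog_simps:
  "length prog = 10"
  "prog ! LOOKUP = lookup_body" "prog ! Suc 0 = arms_body" "prog ! DELETE_NODE = delete_node_body"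
  "prog ! CAVITY = cavity_body" "prog ! TELESCOPE = telescope_body" "prog ! DEPTH = depth_body"
  "prog ! SOLUTION = solution_body" "prog ! FIELDS = fields_body" "prog ! EDGE_FIELDS = edge_fields_body"
  "prog ! COUPLINGS = couplings_body"
  by (simp_all add: prog_def)

section \<open>Correctness and running time of the program\<close>

definition total_field :: "(nat \<times> real) list \<Rightarrow> nat \<Rightarrow> real" where
  "total_field H w = (\<Sum>(u, x)\<leftarrow>H. if u = w then x else 0)"

lemma total_field_Cons: "total_field ((w, K) # H) = (total_field H)(w := total_field H w + K)"
  by (auto simp: total_field_def fun_eq_iff)

definition enc_fields :: "(nat \<times> real) list \<Rightarrow> val" where
  "enc_fields = enc_list (\<lambda>(w, x). Cell (enc_nat w) (Num x))"

definition enc_edges :: "(nat \<times> nat \<Rightarrow> real) \<Rightarrow> (nat \<times> nat) list \<Rightarrow> val" where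
  "enc_edges k = enc_list (\<lambda>e. Cell (enc_nat (fst e)) (Cell (enc_nat (snd e)) (Num (k e))))"

fun enc_depth :: "nat \<Rightarrow> val" where
  "enc_depth 0 = Null"
| "enc_depth (Suc r) = Cell Null (enc_depth r)"

lemma lookup_run:
  "yields (20 * length H + 20) (Num (total_field H w)) (run prog LOOKUP [enc_nat w, enc_fields H])"
proof (induction H)
  case Nil
  show ?case
    by (rule yields_runI) (simp_all add: prog_simps lookup_body_def enc_fields_def total_field_def)
next
  case (Cons a H)
  obtain u x where a: "a = (u, x)" by (cases a)
  obtain t where t: "run prog LOOKUP [enc_nat w, enc_fields H] = Some (Num (total_field H w), t)" "t \<le> 20 * length H + 20"
    using Cons by (rule yieldsE)
  have enc: "enc_fields ((u, x) # H) = Cell (Cell (enc_nat u) (Num x)) (enc_fields H)"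
    by (simp add: enc_fields_def)
  show ?case
    by (rule yields_runI) (use t in \<open>simp_all add: prog_simps lookup_body_def enc a total_field_Cons, simp add: enc_nat_def\<close>)
qed

lemma arms_run:
  "yields (40 * length Es + 20) (enc_fields (arms k v Es)) (run prog ARMS [enc_nat v, enc_edges k Es])"
proof (induction Es)
  case Nil
  show ?case
    by (rule yields_runI) (simp_all add: prog_simps arms_body_def enc_fields_def enc_edges_def arms_def)
next
  case (Cons e Es)
  obtain t where t: "run prog ARMS [enc_nat v, enc_edges k Es] = Some (enc_fields (arms k v Es), t)" "t \<le> 40 * length Es + 20"
    using Cons by (rule yieldsE)
  have enc: "enc_edges k (e # Es) = Cell (Cell (enc_nat (fst e)) (Cell (enc_nat (snd e)) (Num (k e)))) (enc_edges k Es)"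
    by (simp add: enc_edges_def)
  have arms: "arms k v (e # Es) = (if incident v e then [(other v e, k e)] else []) @ arms k v Es"
    by (simp add: arms_def)
  show ?case
    by (rule yields_runI) (use t in \<open>simp_all add: prog_simps arms_body_def enc arms,
      auto simp: enc_nat_def enc_fields_def incident_def other_def\<close>)
qed

lemma delete_node_run:
  "yields (40 * length Es + 20) (enc_edges k (delete_node v Es)) (run prog DELETE_NODE [enc_nat v, enc_edges k Es])"
proof (induction Es)
  case Nil
  show ?case
    by (rule yields_runI) (simp_all add: prog_simps delete_node_body_def enc_fields_def enc_edges_def delete_node_def)
next
  case (Cons e Es)
  obtain t where t: "run prog DELETE_NODE [enc_nat v, enc_edges k Es] = Some (enc_edges k (delete_node v Es), t)" "t \<le> 40 * length Es + 20"
    using Cons by (rule yieldsE)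
  have enc: "enc_edges k (e # Es) = Cell (Cell (enc_nat (fst e)) (Cell (enc_nat (snd e)) (Num (k e)))) (enc_edges k Es)" for e Es
    by (simp add: enc_edges_def)
  have delete_node: "delete_node v (e # Es) = (if incident v e then delete_node v Es else e # delete_node v Es)"
    by (simp add: delete_node_def)
  show ?case
    by (rule yields_runI) (use t in \<open>simp_all add: prog_simps delete_node_body_def enc delete_node,
      auto simp: enc_nat_def enc incident_def\<close>)
qed

text \<open>
  \<open>S\<close> bounds the number of fields during the whole loop, in which every round adds one.
\<close>

lemma telescope_run:
  assumes "\<And>w H. length H \<le> S \<Longrightarrow>
      yields b (Num (cavity k r Es w (total_field H))) (run prog CAVITY [enc_depth r, enc_nat w, enc_fields H, enc_edges k Es])"
    and "length H + length N \<le> S"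
  shows "yields (length N * (20 * S + 60 + b) + 20) (Num (telescope (cavity k r Es) N (total_field H)))
    (run prog TELESCOPE [enc_depth r, enc_fields N, enc_fields H, enc_edges k Es])"
  using assms(2)
proof (induction N arbitrary: H)
  case Nil
  show ?case
    by (rule yields_runI) (simp_all add: prog_simps telescope_body_def enc_fields_def)
next
  case (Cons a N)
  obtain w K where a: "a = (w, K)" by (cases a)
  have enc: "enc_fields ((w, K) # H) = Cell (Cell (enc_nat w) (Num K)) (enc_fields H)" for H
    by (simp add: enc_fields_def)
  obtain t1 where t1: "run prog LOOKUP [enc_nat w, enc_fields H] = Some (Num (total_field H w), t1)" "t1 \<le> 20 * length H + 20"
    using lookup_run by (rule yieldsE)
  obtain t2 where t2: "run prog CAVITY [enc_depth r, enc_nat w, enc_fields H, enc_edges k Es] =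
      Some (Num (cavity k r Es w (total_field H)), t2)" "t2 \<le> b"
    using assms(1)[of H w] Cons.prems by (auto elim: yieldsE)
  have "length (a # H) + length N \<le> S" using Cons.prems by simp
  from Cons.IH[OF this]
  obtain t3 where t3: "run prog TELESCOPE [enc_depth r, enc_fields N, enc_fields (a # H), enc_edges k Es] =
      Some (Num (telescope (cavity k r Es) N (total_field (a # H))), t3)" "t3 \<le> length N * (20 * S + 60 + b) + 20"
    by (rule yieldsE)
  show ?case
    by (rule yields_runI) (use t1 t2 t3 Cons.prems in \<open>simp_all add: prog_simps telescope_body_def enc a total_field_Cons,
      auto simp: response_def max_def\<close>)
qed

text \<open>
  Let \<open>b\<close> be the bound for depth \<open>r\<close>. At depth \<open>Suc r\<close> there are at most \<open>\<Delta>\<close> recursive calls, and the work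
  outside of them is at most \<open>200 * (m + S + 1) * (\<Delta> + 1) \<le> b\<close>, which gives \<open>(\<Delta> + 1) * b\<close> in total.
\<close>

lemma cavity_run:
  assumes "\<And>u. length (filter (incident u) Es) \<le> \<Delta>" "length Es \<le> m" "length H + \<Delta> * r \<le> S"
  shows "yields (200 * (m + S + 1) * (\<Delta> + 1) ^ (r + 1)) (Num (cavity k r Es v (total_field H)))
    (run prog CAVITY [enc_depth r, enc_nat v, enc_fields H, enc_edges k Es])"
  using assms
proof (induction r arbitrary: Es H v)
  case 0
  have "3 \<le> 200 * (m + S + 1) * (\<Delta> + 1)" by simp
  then show ?case
    by (intro yields_runI) (simp_all add: prog_simps cavity_body_def)
next
  case (Suc r)
  let ?R = "delete_node v Es" and ?N = "arms k v Es"
  define b where "b = 200 * (m + S + 1) * (\<Delta> + 1) ^ (r + 1)"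
  have N: "length ?N \<le> \<Delta>" using Suc.prems(1)[of v] by (simp add: arms_def)
  have deg: "length (filter (incident u) ?R) \<le> \<Delta>" for u
    using Suc.prems(1)[of u] length_filter_le[of "\<lambda>e. \<not> incident v e" "filter (incident u) Es"]
    by (simp add: delete_node_def conj_commute)
  have R: "length ?R \<le> m"
    unfolding delete_node_def by (rule order_trans[OF length_filter_le Suc.prems(2)])
  obtain t1 where t1: "run prog ARMS [enc_nat v, enc_edges k Es] = Some (enc_fields ?N, t1)" "t1 \<le> 40 * length Es + 20"
    using arms_run by (rule yieldsE)
  obtain t2 where t2: "run prog DELETE_NODE [enc_nat v, enc_edges k Es] = Some (enc_edges k ?R, t2)" "t2 \<le> 40 * length Es + 20"
    using delete_node_run by (rule yieldsE)
  have "yields b (Num (cavity k r ?R w (total_field H'))) (run prog CAVITY [enc_depth r, enc_nat w, enc_fields H', enc_edges k ?R])"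
    if "length H' \<le> length H + \<Delta>" for w H'
    unfolding b_def using that Suc.prems(3) by (intro Suc.IH deg R) simp
  then have "yields (length ?N * (20 * (length H + \<Delta>) + 60 + b) + 20) (Num (telescope (cavity k r ?R) ?N (total_field H)))
    (run prog TELESCOPE [enc_depth r, enc_fields ?N, enc_fields H, enc_edges k ?R])"
    using N by (intro telescope_run) auto
  then obtain t3 where t3: "run prog TELESCOPE [enc_depth r, enc_fields ?N, enc_fields H, enc_edges k ?R] =
      Some (Num (telescope (cavity k r ?R) ?N (total_field H)), t3)" "t3 \<le> length ?N * (20 * (length H + \<Delta>) + 60 + b) + 20"
    by (rule yieldsE)
  have "length ?N * (20 * (length H + \<Delta>) + 60 + b) \<le> \<Delta> * (20 * S + 60 + b)"
    using N Suc.prems(3) by (intro mult_mono) auto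
  then have "t1 + t2 + t3 + 20 \<le> 80 * m + 80 + \<Delta> * (20 * S + 60) + \<Delta> * b"
    using t1(2) t2(2) t3(2) Suc.prems(2) by (simp add: algebra_simps)
  also have "80 * m + 80 + \<Delta> * (20 * S + 60) \<le> 200 * (m + S + 1) * (\<Delta> + 1)"
    by (simp add: algebra_simps)
  also have "200 * (m + S + 1) * (\<Delta> + 1) \<le> b"
    unfolding b_def by (intro mult_left_mono) (use power_increasing[of 1 "r + 1" "\<Delta> + 1"] in auto)
  also have "b + \<Delta> * b = 200 * (m + S + 1) * (\<Delta> + 1) ^ (Suc r + 1)"
    by (simp add: b_def algebra_simps)
  finally have "t1 + t2 + t3 + 20 \<le> 200 * (m + S + 1) * (\<Delta> + 1) ^ (Suc r + 1)" by simp
  then show ?case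
    by (intro yields_runI) (simp_all add: prog_simps cavity_body_def t1(1)[unfolded One_nat_def] t2(1) t3(1))
qed

lemma depth_run:
  assumes "N \<le> 2 ^ j * y" "\<And>i. i < j \<Longrightarrow> 2 ^ i * y < N"
  shows "yields (20 * j + 20) (enc_depth (4 * j)) (run prog DEPTH [Num y, Num N])"
  using assms
proof (induction j arbitrary: y)
  case 0
  then show ?case by (intro yields_runI) (simp_all add: prog_simps depth_body_def)
next
  case (Suc j)
  have "yields (20 * j + 20) (enc_depth (4 * j)) (run prog DEPTH [Num (y + y), Num N])"
  proof (rule Suc.IH)
    show "N \<le> 2 ^ j * (y + y)" using Suc.prems(1) by (simp add: algebra_simps)
    show "2 ^ i * (y + y) < N" if "i < j" for i using Suc.prems(2)[of "Suc i"] that by (simp add: algebra_simps)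
  qed
  then obtain t where "run prog DEPTH [Num (y + y), Num N] = Some (enc_depth (4 * j), t)" "t \<le> 20 * j + 20"
    by (rule yieldsE)
  moreover have "\<not> N \<le> y" using Suc.prems(2)[of 0] by simp
  moreover have "enc_depth (4 + k) = Cell Null (Cell Null (Cell Null (Cell Null (enc_depth k))))" for k
    by (simp add: numeral_eq_Suc)
  ultimately show ?case
    by (intro yields_runI) (simp_all add: prog_simps depth_body_def)
qed

lemma solution_run:
  assumes "\<And>v. yields b (Num (c v)) (run prog CAVITY [R, enc_nat v, enc_fields H, L])" and "i \<le> n"
  shows "yields ((n - i) * (20 * length H + 60 + b) + 20)
    (enc_list (\<lambda>v. enc_nat (if 0 < total_field H v + c v then 1 else 0)) [i..<n])
    (run prog SOLUTION [enc_nat i, enc_nat n, R, enc_fields H, L])"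
  using assms(2)
proof (induction i rule: inc_induct)
  case base
  show ?case by (rule yields_runI) (simp_all add: prog_simps solution_body_def enc_nat_def)
next
  case (step i)
  obtain t1 where t1: "run prog LOOKUP [enc_nat i, enc_fields H] = Some (Num (total_field H i), t1)" "t1 \<le> 20 * length H + 20"
    using lookup_run by (rule yieldsE)
  obtain t2 where t2: "run prog CAVITY [R, enc_nat i, enc_fields H, L] = Some (Num (c i), t2)" "t2 \<le> b"
    using assms(1) by (rule yieldsE)
  obtain t3 where t3: "run prog SOLUTION [enc_nat (Suc i), enc_nat n, R, enc_fields H, L] =
      Some (enc_list (\<lambda>v. enc_nat (if 0 < total_field H v + c v then 1 else 0)) [Suc i..<n], t3)"
      "t3 \<le> (n - Suc i) * (20 * length H + 60 + b) + 20"
    using step.IH by (rule yieldsE)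
  have suc: "enc_nat (Suc i) = Num (1 + real i)" by (simp add: enc_nat_def)
  have "n - i = Suc (n - Suc i)" using step.hyps by simp
  then have "t1 + t2 + t3 + 40 \<le> (n - i) * (20 * length H + 60 + b) + 20"
    using t1(2) t2(2) t3(2) by simp
  then show ?case
    using step.hyps t1(1) t2(1) t3(1)
    by (intro yields_runI)
      (simp_all add: prog_simps solution_body_def enc_nat_def upt_conv_Cons suc[unfolded enc_nat_def])
qed

lemma fields_run:
  assumes "i \<le> n"
  shows "yields ((n - i) * 40 + 20) (enc_fields (map (\<lambda>v. (v, p v 1)) [i..<n] @ A))
    (run prog FIELDS [enc_nat i, enc_list (\<lambda>v. enc_list (\<lambda>a. Num (p v a)) [0..<2]) [i..<n], enc_fields A])"
  using assms
proof (induction i rule: inc_induct)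
  case base
  show ?case by (rule yields_runI) (simp_all add: prog_simps fields_body_def)
next
  case (step i)
  obtain t where t: "run prog FIELDS [enc_nat (Suc i), enc_list (\<lambda>v. enc_list (\<lambda>a. Num (p v a)) [0..<2]) [Suc i..<n], enc_fields A] =
      Some (enc_fields (map (\<lambda>v. (v, p v 1)) [Suc i..<n] @ A), t)" "t \<le> (n - Suc i) * 40 + 20"
    using step.IH by (rule yieldsE)
  have suc: "enc_nat (Suc i) = Num (1 + real i)" by (simp add: enc_nat_def)
  have "n - i = Suc (n - Suc i)" using step.hyps by simp
  then have "t + 40 \<le> (n - i) * 40 + 20" using t(2) by simp
  moreover have "[0..<2] = [0, 1 :: nat]" by (simp add: upt_rec)
  ultimately show ?case
    using step.hyps t(1)
    by (intro yields_runI)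
      (simp_all add: prog_simps fields_body_def enc_nat_def upt_conv_Cons suc[unfolded enc_nat_def] enc_fields_def)
qed

definition enc_interactions :: "(nat \<times> nat \<Rightarrow> nat \<Rightarrow> nat \<Rightarrow> real) \<Rightarrow> (nat \<times> nat) list \<Rightarrow> val" where
  "enc_interactions w = enc_list (\<lambda>e. Cell (enc_nat (fst e)) (Cell (enc_nat (snd e))
    (Cell (Cell (Num (w e 0 0)) (Cell (Num (w e 0 1)) Null))
      (Cell (Cell (Num (w e 1 0)) (Cell (Num (w e 1 1)) Null)) Null))))"

definition edge_entries :: "(nat \<times> nat \<Rightarrow> nat \<Rightarrow> nat \<Rightarrow> real) \<Rightarrow> (nat \<times> nat) list \<Rightarrow> (nat \<times> real) list" where
  "edge_entries w Es = concat (map (\<lambda>e. [(fst e, w e 1 0 - w e 0 0), (snd e, w e 0 1 - w e 0 0)]) Es)"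

lemma edge_fields_run:
  "yields (60 * length Es + 20) (enc_fields (edge_entries w Es)) (run prog EDGE_FIELDS [enc_interactions w Es])"
proof (induction Es)
  case Nil
  show ?case
    by (rule yields_runI)
      (simp_all add: prog_simps edge_fields_body_def Uncons_edge_def enc_fields_def edge_entries_def enc_interactions_def)
next
  case (Cons e Es)
  then obtain t where "run prog EDGE_FIELDS [enc_interactions w Es] = Some (enc_fields (edge_entries w Es), t)"
    "t \<le> 60 * length Es + 20" by (rule yieldsE)
  then show ?case
    by (intro yields_runI)
      (simp_all add: prog_simps edge_fields_body_def Uncons_edge_def enc_fields_def edge_entries_def enc_interactions_def enc_nat_def)
qed

lemma couplings_run:
  "yields (60 * length Es + 20) (enc_edges (\<lambda>e. w e 1 1 - w e 1 0 - w e 0 1 + w e 0 0) Es)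
    (run prog COUPLINGS [enc_interactions w Es])"
proof (induction Es)
  case Nil
  show ?case
    by (rule yields_runI)
      (simp_all add: prog_simps couplings_body_def Uncons_edge_def enc_edges_def enc_interactions_def)
next
  case (Cons e Es)
  then obtain t where "run prog COUPLINGS [enc_interactions w Es] =
      Some (enc_edges (\<lambda>e. w e 1 1 - w e 1 0 - w e 0 1 + w e 0 0) Es, t)"
    "t \<le> 60 * length Es + 20" by (rule yieldsE)
  then show ?case
    by (intro yields_runI)
      (simp_all add: prog_simps couplings_body_def Uncons_edge_def enc_edges_def enc_interactions_def enc_nat_def)
qed

lemma multiple_interp:
  "i < length env \<Longrightarrow> env ! i = Num x \<Longrightarrow> interp \<phi> env (multiple C (Var i)) = Some (Num (real C * x), 2 * C + 1)"
  by (induction C) (simp_all add: algebra_simps)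

lemma main_eval:
  fixes w :: "nat \<times> nat \<Rightarrow> nat \<Rightarrow> nat \<Rightarrow> real" and p :: "nat \<Rightarrow> nat \<Rightarrow> real"
  assumes deg: "\<And>u. length (filter (incident u) Es) \<le> \<Delta>"
    and j: "real C * real n \<le> 2 ^ j * \<epsilon>" "\<And>i. i < j \<Longrightarrow> 2 ^ i * \<epsilon> < real C * real n"
  defines "H \<equiv> map (\<lambda>v. (v, p v 1)) [0..<n] @ edge_entries w Es"
  shows "\<exists>t. eval prog [Num \<epsilon>, Cell (enc_nat n) (Cell T (Cell
        (enc_list (\<lambda>v. enc_list (\<lambda>a. Num (p v a)) [0..<2]) [0..<n]) (enc_interactions w Es)))] (main_exp C)
      (enc_list (\<lambda>v. enc_nat (if 0 < total_field H v +
        cavity (\<lambda>e. w e 1 1 - w e 1 0 - w e 0 1 + w e 0 0) (4 * j) Es v (total_field H) then 1 else 0)) [0..<n]) t \<and>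
    t \<le> n * (20 * (n + 2 * length Es) + 60 +
        200 * (length Es + (n + 2 * length Es + \<Delta> * (4 * j)) + 1) * (\<Delta> + 1) ^ (4 * j + 1))
      + 20 * j + 40 * n + 120 * length Es + 2 * C + 200"
proof -
  let ?k = "\<lambda>e. w e 1 1 - w e 1 0 - w e 0 1 + w e 0 0"
  let ?pots = "enc_list (\<lambda>v. enc_list (\<lambda>a. Num (p v a)) [0..<2]) [0..<n]"
  have lenH: "length H = n + 2 * length Es"
  proof -
    have "length (edge_entries w Es) = 2 * length Es" unfolding edge_entries_def by (induction Es) auto
    then show ?thesis by (simp add: H_def)
  qed
  let ?b = "200 * (length Es + (n + 2 * length Es + \<Delta> * (4 * j)) + 1) * (\<Delta> + 1) ^ (4 * j + 1)"
  have cavity: "yields ?b (Num (cavity ?k (4 * j) Es v (total_field H)))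
      (run prog CAVITY [enc_depth (4 * j), enc_nat v, enc_fields H, enc_edges ?k Es])" for v
    by (rule cavity_run[OF deg]) (simp_all add: lenH)
  obtain t1 where t1: "run prog EDGE_FIELDS [enc_interactions w Es] = Some (enc_fields (edge_entries w Es), t1)"
    "t1 \<le> 60 * length Es + 20" using edge_fields_run by (rule yieldsE)
  obtain t2 where t2: "run prog COUPLINGS [enc_interactions w Es] = Some (enc_edges ?k Es, t2)"
    "t2 \<le> 60 * length Es + 20" using couplings_run by (rule yieldsE)
  obtain t3 where t3: "run prog FIELDS [enc_nat 0, ?pots, enc_fields (edge_entries w Es)] = Some (enc_fields H, t3)"
    "t3 \<le> (n - 0) * 40 + 20" unfolding H_def using fields_run[of 0 n p "edge_entries w Es"] by (auto elim: yieldsE)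
  obtain t4 where t4: "run prog DEPTH [Num \<epsilon>, Num (real C * real n)] = Some (enc_depth (4 * j), t4)" "t4 \<le> 20 * j + 20"
    using depth_run[OF j] by (rule yieldsE)
  obtain t5 where t5: "run prog SOLUTION [enc_nat 0, enc_nat n, enc_depth (4 * j), enc_fields H, enc_edges ?k Es] =
      Some (enc_list (\<lambda>v. enc_nat (if 0 < total_field H v + cavity ?k (4 * j) Es v (total_field H) then 1 else 0)) [0..<n], t5)"
    "t5 \<le> (n - 0) * (20 * length H + 60 + ?b) + 20"
    using solution_run[OF cavity, of 0 n] by (auto elim: yieldsE)
  have z: "enc_nat 0 = Num 0" by (simp add: enc_nat_def)
  have "interp (run prog) [Num \<epsilon>, Cell (enc_nat n) (Cell T (Cell ?pots (enc_interactions w Es)))] (main_exp C) =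
    Some (enc_list (\<lambda>v. enc_nat (if 0 < total_field H v + cavity ?k (4 * j) Es v (total_field H) then 1 else 0)) [0..<n],
      t1 + t2 + t3 + t4 + t5 + 2 * C + 19)"
    using t1(1) t2(1) t3(1) t4(1) t5(1) multiple_interp[of 4 "[?pots, enc_interactions w Es, T, Cell ?pots (enc_interactions w Es), enc_nat n,
      Cell T (Cell ?pots (enc_interactions w Es)), Num \<epsilon>, Cell (enc_nat n) (Cell T (Cell ?pots (enc_interactions w Es)))]" "real n" "run prog" C]
    by (simp add: main_exp_def z enc_nat_def)
  then have "eval prog [Num \<epsilon>, Cell (enc_nat n) (Cell T (Cell ?pots (enc_interactions w Es)))] (main_exp C)
    (enc_list (\<lambda>v. enc_nat (if 0 < total_field H v + cavity ?k (4 * j) Es v (total_field H) then 1 else 0)) [0..<n])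
      (t1 + t2 + t3 + t4 + t5 + 2 * C + 19)"
    by (intro interp_sound[where \<phi> = "run prog"] run_sound)
  moreover have "t1 + t2 + t3 + t4 + t5 + 2 * C + 19 \<le> n * (20 * (n + 2 * length Es) + 60 + ?b)
      + 20 * j + 40 * n + 120 * length Es + 2 * C + 200"
    using t1(2) t2(2) t3(2) t4(2) t5(2) by (simp add: lenH)
  ultimately show ?thesis by blast
qed

section \<open>The approximation scheme\<close>

lemma measurable_qubo:
  assumes "\<And>v. v < n \<Longrightarrow> (\<lambda>\<omega>. h \<omega> v) \<in> borel_measurable Q"
    and "\<And>e. e \<in> set Es \<Longrightarrow> (\<lambda>\<omega>. k \<omega> e) \<in> borel_measurable Q"
  shows "(\<lambda>\<omega>. qubo n (h \<omega>) (k \<omega>) Es x) \<in> borel_measurable Q"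
proof -
  have "(\<lambda>\<omega>. \<Sum>e\<leftarrow>F. k \<omega> e * real (x (fst e)) * real (x (snd e))) \<in> borel_measurable Q" if "set F \<subseteq> set Es" for F
    using that
  proof (induction F)
    case (Cons e F)
    then have "(\<lambda>\<omega>. k \<omega> e) \<in> borel_measurable Q"
      "(\<lambda>\<omega>. \<Sum>e\<leftarrow>F. k \<omega> e * real (x (fst e)) * real (x (snd e))) \<in> borel_measurable Q"
      using assms(2) by simp_all
    then show ?case by simp
  qed simp
  moreover have "(\<lambda>\<omega>. \<Sum>v<n. h \<omega> v * real (x v)) \<in> borel_measurable Q"
    using assms(1) by (intro borel_measurable_sum borel_measurable_times) auto
  ultimately show ?thesis unfolding qubo_def by (intro borel_measurable_add) simp_all
qed

text \<open>
  The optimum exceeds a number iff one of finitely many solutions does, and the estimated solution takes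
  finitely many values; both conditions are finite combinations of measurable ones.
\<close>

lemma measurable_gap:
  fixes X :: "param \<Rightarrow> 'w \<Rightarrow> real"
  assumes Es: "distinct Es" "set Es = E" "endpoints Es \<subseteq> {..<n}" "loopless Es"
    and X: "\<And>u. u < n \<Longrightarrow> X (Node u) \<in> borel_measurable M"
      "\<And>e a b. e \<in> set Es \<Longrightarrow> a < 2 \<Longrightarrow> b < 2 \<Longrightarrow> X (Edge e a b) \<in> borel_measurable M"
  shows "{\<omega> \<in> space M. optimum (binary_network n E X \<omega>) -
      objective (binary_network n E X \<omega>) (estimated_solution r n Es (\<lambda>i. X i \<omega>)) > ereal \<epsilon>} \<in> sets M"
proof -
  let ?q = "\<lambda>x \<omega>. qubo n (node_field (\<lambda>i. X i \<omega>) Es) (coupling (\<lambda>i. X i \<omega>)) Es x"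
  let ?x = "\<lambda>\<omega>. estimated_solution r n Es (\<lambda>i. X i \<omega>)"
  have q [measurable]: "?q x \<in> borel_measurable M" for x
  proof (rule measurable_qubo)
    show "(\<lambda>\<omega>. node_field (\<lambda>i. X i \<omega>) Es v) \<in> borel_measurable M" if "v < n" for v
      by (rule measurable_node_field) (use X that in auto)
    show "(\<lambda>\<omega>. coupling (\<lambda>i. X i \<omega>) e) \<in> borel_measurable M" if "e \<in> set Es" for e
      by (rule measurable_coupling) (use X that in auto)
  qed
  have peak_gt: "peak n (node_field (\<lambda>i. X i \<omega>) Es) (coupling (\<lambda>i. X i \<omega>)) Es > c \<longleftrightarrow> (\<exists>y\<in>sols n. ?q y \<omega> > c)" for \<omega> c
  proof -
    have "sols n \<noteq> {}" using peak_attained[of n] by blast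
    then show ?thesis unfolding peak_def by (subst Max_gr_iff) (auto intro: finite_imageI[OF finite_sols])
  qed
  have "optimum (binary_network n E X \<omega>) - objective (binary_network n E X \<omega>) (?x \<omega>) > ereal \<epsilon> \<longleftrightarrow>
      peak n (node_field (\<lambda>i. X i \<omega>) Es) (coupling (\<lambda>i. X i \<omega>)) Es > ?q (?x \<omega>) \<omega> + \<epsilon>" for \<omega>
    unfolding objective_qubo[OF Es(1-3) estimated_solution_mem] optimum_qubo[OF Es(1-3)] by auto
  then have "{\<omega> \<in> space M. optimum (binary_network n E X \<omega>) - objective (binary_network n E X \<omega>) (?x \<omega>) > ereal \<epsilon>} =
      {\<omega> \<in> space M. \<exists>x\<in>sols n. ?x \<omega> = x \<and> (\<exists>y\<in>sols n. ?q y \<omega> > ?q x \<omega> + \<epsilon>)}"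
    using estimated_solution_mem by (auto simp: peak_gt)
  also have "\<dots> \<in> sets M"
  proof -
    have "Measurable.pred M (\<lambda>\<omega>. ?x \<omega> = x)" if x: "x \<in> sols n" for x
    proof -
      have m: "Measurable.pred M (\<lambda>\<omega>. \<forall>v\<in>{..<n}. (estimate r (\<lambda>i. X i \<omega>) Es v > 0) = (x v = 1))"
      proof (rule pred_intros_finite(3))
        fix v assume "v \<in> {..<n}"
        then have [measurable]: "(\<lambda>\<omega>. estimate r (\<lambda>i. X i \<omega>) Es v) \<in> borel_measurable M"
          by (intro measurable_estimate[OF Es(4,3)]) (use X in auto)
        show "Measurable.pred M (\<lambda>\<omega>. (estimate r (\<lambda>i. X i \<omega>) Es v > 0) = (x v = 1))"
          by measurable
      qed simp
      have eq: "?x \<omega> = x \<longleftrightarrow> (\<forall>v\<in>{..<n}. (estimate r (\<lambda>i. X i \<omega>) Es v > 0) = (x v = 1))" for \<omega>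
      proof
        assume "\<forall>v\<in>{..<n}. (estimate r (\<lambda>i. X i \<omega>) Es v > 0) = (x v = 1)"
        then show "?x \<omega> = x"
          using PiE_mem[OF x] less_2_cases
          by (intro PiE_ext[OF estimated_solution_mem x]) (fastforce simp: estimated_solution_def)
      qed (auto simp: estimated_solution_def split: if_splits)
      show ?thesis unfolding eq by (rule m)
    qed
    moreover have "Measurable.pred M (\<lambda>\<omega>. ?q y \<omega> > ?q x \<omega> + \<epsilon>)" for x y
      by measurable
    ultimately have "Measurable.pred M (\<lambda>\<omega>. \<exists>x\<in>sols n. ?x \<omega> = x \<and> (\<exists>y\<in>sols n. ?q y \<omega> > ?q x \<omega> + \<epsilon>))"
      by (intro pred_intros_finite(4) finite_sols pred_intros_logic)
    then show ?thesis by (simp add: pred_def)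
  qed
  finally show ?thesis .
qed

text \<open>
  If no estimate straddles 0 together with the true bonus, the solution is optimal and the gap is 0; the
  rest is a union bound over the nodes.
\<close>

lemma prob_gap:
  fixes X :: "param \<Rightarrow> 'w \<Rightarrow> real"
  assumes M: "prob_space M" and I: "0 < I1" "0 < I2"
    and Es: "distinct Es" "set Es = E" "endpoints Es \<subseteq> {..<n}" "loopless Es" "\<And>u. length (filter (incident u) Es) \<le> \<Delta>"
    and nodes: "\<And>u. u < n \<Longrightarrow> uniform_on M (X (Node u)) I1"
    and edges: "\<And>e a b. e \<in> E \<Longrightarrow> a < 2 \<Longrightarrow> b < 2 \<Longrightarrow> uniform_on M (X (Edge e a b)) I2"
    and indep: "prob_space.indep_vars M (\<lambda>_. borel) X
          ({Node u | u. u < n} \<union> {Edge e a b | e a b. e \<in> E \<and> a < 2 \<and> b < 2})"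
    and \<epsilon>: "0 < \<epsilon>"
  shows "measure M {\<omega> \<in> space M. optimum (binary_network n E X \<omega>) -
      objective (binary_network n E X \<omega>) (estimated_solution r n Es (\<lambda>i. X i \<omega>)) > ereal \<epsilon>} \<le>
    real n * (2 * real \<Delta> * I2 / I1 * (2 * real (\<Delta> - 1) * I2 / I1) ^ r)"
proof -
  interpret prob_space M by (rule M)
  note edges = edges[folded Es(2)] and indep = indep[folded Es(2)]
  define r' where "r' = max r (length Es)"
  have r': "r \<le> r'" "length Es \<le> r'" by (auto simp: r'_def)
  define S where "S = (\<lambda>v. {\<omega> \<in> space M. straddle (estimate r (\<lambda>i. X i \<omega>) Es v) (estimate r' (\<lambda>i. X i \<omega>) Es v)})"
  have S: "S v \<in> sets M" if "v < n" for v
  proof -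
    have [measurable]: "(\<lambda>\<omega>. estimate s (\<lambda>i. X i \<omega>) Es v) \<in> borel_measurable M" for s
      by (rule measurable_estimate[OF Es(4,3) that])
        (use uniform_on_distr(1)[OF nodes I(1)] uniform_on_distr(1)[OF edges I(2)] in auto)
    show ?thesis unfolding S_def straddle_def by measurable
  qed
  have "{\<omega> \<in> space M. optimum (binary_network n E X \<omega>) -
      objective (binary_network n E X \<omega>) (estimated_solution r n Es (\<lambda>i. X i \<omega>)) > ereal \<epsilon>} \<subseteq> (\<Union>v<n. S v)"
  proof safe
    fix \<omega> assume \<omega>: "\<omega> \<in> space M" and gap: "ereal \<epsilon> < optimum (binary_network n E X \<omega>) -
      objective (binary_network n E X \<omega>) (estimated_solution r n Es (\<lambda>i. X i \<omega>))"
    show "\<omega> \<in> (\<Union>v<n. S v)"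
    proof (rule ccontr)
      assume "\<omega> \<notin> (\<Union>v<n. S v)"
      then have "objective (binary_network n E X \<omega>) (estimated_solution r n Es (\<lambda>i. X i \<omega>)) = optimum (binary_network n E X \<omega>)"
        using \<omega> by (intro estimated_solution_optimal[OF Es(1-4) r'(2)]) (auto simp: S_def)
      with gap \<epsilon> show False
        using optimum_qubo[OF Es(1-3), of X \<omega>] by simp
    qed
  qed
  then have "measure M {\<omega> \<in> space M. optimum (binary_network n E X \<omega>) -
      objective (binary_network n E X \<omega>) (estimated_solution r n Es (\<lambda>i. X i \<omega>)) > ereal \<epsilon>} \<le> measure M (\<Union>v<n. S v)"
    using S by (intro finite_measure_mono) auto
  also have "\<dots> \<le> (\<Sum>v<n. measure M (S v))"
    using S by (intro finite_measure_subadditive_finite) auto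
  also have "\<dots> \<le> (\<Sum>v<n. 2 * real \<Delta> * I2 / I1 * (2 * real (\<Delta> - 1) * I2 / I1) ^ r)"
    unfolding S_def
    by (intro sum_mono prob_straddle[OF M I Es(4,3,5) nodes edges indep r'(1)]) auto
  finally show ?thesis by simp
qed

lemma enc_list_cong: "(\<And>v. v \<in> set xs \<Longrightarrow> f v = g v) \<Longrightarrow> enc_list f xs = enc_list g xs"
  by (induction xs) auto

lemma enc_binary_network:
  fixes X :: "param \<Rightarrow> 'w \<Rightarrow> real"
  shows "enc_network (binary_network n E X \<omega>) = Cell (enc_nat n) (Cell (enc_nat 2) (Cell
    (enc_list (\<lambda>v. enc_list (\<lambda>a. Num (if a = 0 then 0 else X (Node v) \<omega>)) [0..<2]) [0..<n])
    (enc_interactions (\<lambda>e a b. X (Edge e a b) \<omega>) (filter (\<lambda>e. e \<in> E) (List.product [0..<n] [0..<n])))))"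
proof -
  have "[0..<2] = [0, 1 :: nat]" by (simp add: upt_rec)
  then show ?thesis
    by (simp add: enc_network_def binary_network_def enc_interactions_def split_def enc_ereal_def)
qed

lemma total_field_network:
  assumes "v < n"
  shows "total_field (map (\<lambda>v. (v, if 1 = (0 :: nat) then 0 else y (Node v))) [0..<n] @ edge_entries (\<lambda>e a b. y (Edge e a b)) Es) v =
    node_field y Es v"
proof -
  have "total_field (edge_entries (\<lambda>e a b. y (Edge e a b)) Es) v = edge_field y Es v"
    by (induction Es) (auto simp: total_field_def edge_entries_def edge_field_def)
  moreover have "(\<Sum>u\<leftarrow>[0..<n]. if u = v then y (Node u) else 0) = y (Node v)"
    using assms by (simp add: sum_list_distinct_conv_sum_set)
  ultimately show ?thesis by (simp add: total_field_def node_field_def comp_def)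
qed

definition edge_list :: "nat \<Rightarrow> (nat \<times> nat) set \<Rightarrow> (nat \<times> nat) list" where
  "edge_list n E = filter (\<lambda>e. e \<in> E) (List.product [0..<n] [0..<n])"

text \<open>
  The edges in the order of the input encoding. As each edge is stored in one orientation, the edges at
  \<open>u\<close> are mapped injectively to its neighbours.
\<close>

lemma edge_list:
  assumes "decision_network G" "max_degree G \<le> \<Delta>" "num_nodes G = n" "edges G = E"
  shows "distinct (edge_list n E)" "set (edge_list n E) = E" "endpoints (edge_list n E) \<subseteq> {..<n}"
    "loopless (edge_list n E)" "length (filter (incident u) (edge_list n E)) \<le> \<Delta>" "length (edge_list n E) \<le> n * n"
proof -
  have E: "E \<subseteq> {(u, v). u < v \<and> v < n}" using assms by (auto simp: decision_network_def)
  show d: "distinct (edge_list n E)" by (simp add: edge_list_def distinct_product)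
  show s: "set (edge_list n E) = E" using E by (auto simp: edge_list_def)
  show e: "endpoints (edge_list n E) \<subseteq> {..<n}" using E by (auto simp: endpoints_def s)
  show "loopless (edge_list n E)" using E by (auto simp: loopless_def s)
  show "length (edge_list n E) \<le> n * n"
    using length_filter_le[of "\<lambda>e. e \<in> E" "List.product [0..<n] [0..<n]"] by (simp add: edge_list_def)
  show "length (filter (incident u) (edge_list n E)) \<le> \<Delta>"
  proof (cases "u < n")
    case True
    have "length (filter (incident u) (edge_list n E)) = card {e \<in> E. incident u e}"
      using distinct_card[of "filter (incident u) (edge_list n E)"] d s by simp
    also have "\<dots> \<le> card {w. (w, u) \<in> edges G \<or> (u, w) \<in> edges G}"
    proof (rule card_inj_on_le)
      show "inj_on (other u) {e \<in> E. incident u e}"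
      proof (rule inj_onI)
        fix e e' assume e: "e \<in> {e \<in> E. incident u e}" "e' \<in> {e \<in> E. incident u e}" "other u e = other u e'"
        obtain a b where ab: "e = (a, b)" "a < b" using e(1) E by blast
        obtain a' b' where ab': "e' = (a', b')" "a' < b'" using e(2) E by blast
        show "e = e'" using e ab ab' by (auto simp: other_def incident_def split: if_splits)
      qed
      show "other u ` {e \<in> E. incident u e} \<subseteq> {w. (w, u) \<in> edges G \<or> (u, w) \<in> edges G}"
        by (auto simp: other_def incident_def assms(4))
      have "{w. (w, u) \<in> edges G \<or> (u, w) \<in> edges G} \<subseteq> {..<n}" using E by (auto simp: assms(4))
      then show "finite {w. (w, u) \<in> edges G \<or> (u, w) \<in> edges G}" by (rule finite_subset) simp
    qed
    also have "\<dots> = node_degree G u" by (simp add: node_degree_def)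
    also have "\<dots> \<le> max_degree G"
      unfolding max_degree_def using True assms(3) by (intro Max_ge) auto
    finally show ?thesis using assms(2) by simp
  next
    case False
    then have "\<not> incident u e" if "e \<in> set (edge_list n E)" for e
      using that e by (auto simp: incident_def endpoints_def)
    then have "filter (incident u) (edge_list n E) = []" by (simp add: filter_empty_conv)
    then show ?thesis by simp
  qed
qed

lemma main_outputs:
  fixes X :: "param \<Rightarrow> 'w \<Rightarrow> real"
  assumes deg: "\<And>u. length (filter (incident u) (edge_list n E)) \<le> \<Delta>"
    and Es: "endpoints (edge_list n E) \<subseteq> {..<n}" "loopless (edge_list n E)"
    and j: "real C * real n \<le> 2 ^ j * \<epsilon>" "\<forall>i<j. 2 ^ i * \<epsilon> < real C * real n"
  shows "\<exists>t. outputs_in_time (prog, main_exp C) \<epsilon> (binary_network n E X \<omega>)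
      (estimated_solution (4 * j) n (edge_list n E) (\<lambda>i. X i \<omega>)) t \<and>
    t \<le> n * (20 * (n + 2 * length (edge_list n E)) + 60 +
        200 * (length (edge_list n E) + (n + 2 * length (edge_list n E) + \<Delta> * (4 * j)) + 1) * (\<Delta> + 1) ^ (4 * j + 1))
      + 20 * j + 40 * n + 120 * length (edge_list n E) + 2 * C + 200"
proof -
  let ?Es = "edge_list n E" and ?y = "\<lambda>i. X i \<omega>"
  let ?p = "\<lambda>v a. if a = (0 :: nat) then 0 else X (Node v) \<omega>" and ?w = "\<lambda>e a b. X (Edge e a b) \<omega>"
  let ?H = "map (\<lambda>v. (v, ?p v 1)) [0..<n] @ edge_entries ?w ?Es"
  have "cavity (\<lambda>e. ?w e 1 1 - ?w e 1 0 - ?w e 0 1 + ?w e 0 0) (4 * j) ?Es v (total_field ?H) =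
      cavity (coupling ?y) (4 * j) ?Es v (node_field ?y ?Es)" for v
  proof (rule cavity_cong[OF Es(2)])
    show "\<forall>w\<in>endpoints ?Es - {v}. total_field ?H w = node_field ?y ?Es w"
      using Es(1) total_field_network[of _ n ?y ?Es] by blast
  qed (simp add: coupling_def)
  then have "total_field ?H v + cavity (\<lambda>e. ?w e 1 1 - ?w e 1 0 - ?w e 0 1 + ?w e 0 0) (4 * j) ?Es v (total_field ?H) =
      estimate (4 * j) ?y ?Es v" if "v < n" for v
    using total_field_network[OF that, of ?y ?Es] by (simp add: estimate_def)
  then have "enc_list (\<lambda>v. enc_nat (if 0 < total_field ?H v +
        cavity (\<lambda>e. ?w e 1 1 - ?w e 1 0 - ?w e 0 1 + ?w e 0 0) (4 * j) ?Es v (total_field ?H) then 1 else 0)) [0..<n] =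
      enc_solution (binary_network n E X \<omega>) (estimated_solution (4 * j) n ?Es ?y)"
    by (auto simp: enc_solution_def binary_network_def estimated_solution_def intro!: enc_list_cong)
  then show ?thesis
    using main_eval[OF deg j(1) j(2)[rule_format], where p = ?p and w = ?w and T = "enc_nat 2"]
    unfolding outputs_in_time_def solutions_binary_network enc_binary_network edge_list_def[symmetric] fst_conv snd_conv
    using estimated_solution_mem[of "4 * j" n ?Es ?y] by auto
qed

text \<open>
  The number of doublings is least, hence \<open>2 ^ j\<close> overshoots by at most a factor 2; this is what makes the
  running time polynomial.
\<close>

lemma doubling_depth:
  fixes N \<epsilon> :: real
  assumes "0 < \<epsilon>"
  obtains j where "N \<le> 2 ^ j * \<epsilon>" "\<And>i. i < j \<Longrightarrow> 2 ^ i * \<epsilon> < N" "2 ^ j \<le> max 1 (2 * N / \<epsilon>)"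
proof -
  define j where "j = (LEAST j. N \<le> 2 ^ j * \<epsilon>)"
  obtain m where "N / \<epsilon> < 2 ^ m" using real_arch_pow[of 2 "N / \<epsilon>"] by auto
  then have "N \<le> 2 ^ m * \<epsilon>" using assms by (simp add: field_simps)
  then have 1: "N \<le> 2 ^ j * \<epsilon>" unfolding j_def by (rule LeastI)
  have 2: "2 ^ i * \<epsilon> < N" if "i < j" for i using not_less_Least[of i "\<lambda>j. N \<le> 2 ^ j * \<epsilon>"] that by (simp add: j_def)
  have "2 ^ j \<le> max 1 (2 * N / \<epsilon>)"
  proof (cases j)
    case (Suc i)
    then have "2 ^ i < N / \<epsilon>" using 2[of i] assms by (simp add: field_simps)
    then show ?thesis by (simp add: Suc)
  qed simp
  with 1 2 show thesis by (rule that)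
qed

text \<open>
  Every quantity is bounded by a power of \<open>Y\<close>; the exponential factor is polynomial in \<open>2 ^ j\<close> because
  \<open>\<Delta> + 1 \<le> 2 ^ \<Delta>\<close>.
\<close>

lemma time_bound:
  fixes n m j C \<Delta> t :: nat and Y :: real
  assumes t: "t \<le> n * (20 * (n + 2 * m) + 60 + 200 * (m + (n + 2 * m + \<Delta> * (4 * j)) + 1) * (\<Delta> + 1) ^ (4 * j + 1))
      + 20 * j + 40 * n + 120 * m + 2 * C + 200"
    and n: "real n \<le> Y" and m: "m \<le> n * n" and j: "2 ^ j \<le> Y"
  shows "real t \<le> (500 + 2 * real C + 200 * (5 + 4 * real \<Delta>) * 2 ^ \<Delta>) * Y ^ (4 * \<Delta> + 3)"
proof -
  have Y: "1 \<le> Y" using j one_le_power[of "2 :: real" j] by linarith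
  have jY: "real j \<le> Y" using less_exp[of j] j by (metis less_imp_le of_nat_le_iff of_nat_numeral of_nat_power order_trans)
  have mY: "real m \<le> Y ^ 2"
  proof -
    have "real m \<le> real n * real n" using m by (metis of_nat_le_iff of_nat_mult)
    also have "\<dots> \<le> Y * Y" using n by (intro mult_mono) auto
    finally show ?thesis by (simp add: power2_eq_square)
  qed
  have Y12: "Y \<le> Y ^ 2" using Y by (simp add: self_le_power)
  have pow: "real ((\<Delta> + 1) ^ (4 * j + 1)) \<le> 2 ^ \<Delta> * Y ^ (4 * \<Delta>)"
  proof -
    have "real (\<Delta> + 1) \<le> 2 ^ \<Delta>"
      using less_exp[of \<Delta>] by (metis Suc_eq_plus1 Suc_leI of_nat_le_iff of_nat_numeral of_nat_power)
    then have "real (\<Delta> + 1) ^ (4 * j + 1) \<le> (2 ^ \<Delta>) ^ (4 * j + 1)" by (intro power_mono) auto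
    also have "\<dots> = 2 ^ \<Delta> * (2 ^ j) ^ (4 * \<Delta>)" by (simp add: power_mult[symmetric] power_add[symmetric] algebra_simps)
    also have "\<dots> \<le> 2 ^ \<Delta> * Y ^ (4 * \<Delta>)" using j by (intro mult_left_mono power_mono) auto
    finally show ?thesis unfolding of_nat_power .
  qed
  have size: "real (m + (n + 2 * m + \<Delta> * (4 * j)) + 1) \<le> (5 + 4 * real \<Delta>) * Y ^ 2"
  proof -
    have "real \<Delta> * real j \<le> real \<Delta> * Y ^ 2" using jY Y12 by (intro mult_left_mono) auto
    then show ?thesis using mY n Y Y12 by (simp add: algebra_simps)
  qed
  have up: "Y ^ i \<le> Y ^ (4 * \<Delta> + 3)" if "i \<le> 3" for i using Y that by (intro power_increasing) auto
  have a: "real n * real (20 * (n + 2 * m) + 60) \<le> 120 * Y ^ (4 * \<Delta> + 3)"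
  proof -
    have "real (20 * (n + 2 * m) + 60) \<le> 120 * Y ^ 2" using mY n Y Y12 by simp
    then have "real n * real (20 * (n + 2 * m) + 60) \<le> Y * (120 * Y ^ 2)" using n by (intro mult_mono) auto
    also have "\<dots> = 120 * Y ^ 3" by (simp add: power3_eq_cube power2_eq_square)
    also have "\<dots> \<le> 120 * Y ^ (4 * \<Delta> + 3)" using up[of 3] by simp
    finally show ?thesis .
  qed
  have b: "real n * (200 * real (m + (n + 2 * m + \<Delta> * (4 * j)) + 1) * real ((\<Delta> + 1) ^ (4 * j + 1)))
      \<le> 200 * (5 + 4 * real \<Delta>) * 2 ^ \<Delta> * Y ^ (4 * \<Delta> + 3)"
  proof -
    have "real n * (200 * real (m + (n + 2 * m + \<Delta> * (4 * j)) + 1) * real ((\<Delta> + 1) ^ (4 * j + 1)))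
        \<le> Y * (200 * ((5 + 4 * real \<Delta>) * Y ^ 2) * (2 ^ \<Delta> * Y ^ (4 * \<Delta>)))"
      using n size pow Y by (intro mult_mono mult_nonneg_nonneg) auto
    also have "\<dots> = 200 * (5 + 4 * real \<Delta>) * 2 ^ \<Delta> * Y ^ (4 * \<Delta> + 3)"
      by (simp add: power_add power3_eq_cube power2_eq_square)
    finally show ?thesis .
  qed
  have c: "real (20 * j + 40 * n + 120 * m + 2 * C + 200) \<le> (380 + 2 * real C) * Y ^ (4 * \<Delta> + 3)"
  proof -
    have "real C * 1 \<le> real C * Y ^ (4 * \<Delta> + 3)" using up[of 0] by (intro mult_left_mono) auto
    then show ?thesis using jY n mY up[of 0] up[of 1] up[of 2] by (simp add: algebra_simps)
  qed
  have "real t \<le> real n * real (20 * (n + 2 * m) + 60) +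
      real n * (200 * real (m + (n + 2 * m + \<Delta> * (4 * j)) + 1) * real ((\<Delta> + 1) ^ (4 * j + 1))) +
      real (20 * j + 40 * n + 120 * m + 2 * C + 200)"
  proof -
    have "t \<le> n * (20 * (n + 2 * m) + 60) + n * (200 * (m + (n + 2 * m + \<Delta> * (4 * j)) + 1) * (\<Delta> + 1) ^ (4 * j + 1)) +
      (20 * j + 40 * n + 120 * m + 2 * C + 200)"
      using t by (simp only: add_mult_distrib2)
    from of_nat_mono[OF this, where 'a = real] show ?thesis
      by (simp only: of_nat_add of_nat_mult of_nat_power of_nat_numeral of_nat_1)
  qed
  also have "\<dots> \<le> 120 * Y ^ (4 * \<Delta> + 3) + 200 * (5 + 4 * real \<Delta>) * 2 ^ \<Delta> * Y ^ (4 * \<Delta> + 3) + (380 + 2 * real C) * Y ^ (4 * \<Delta> + 3)"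
    by (intro add_mono a b c)
  also have "\<dots> = (500 + 2 * real C + 200 * (5 + 4 * real \<Delta>) * 2 ^ \<Delta>) * Y ^ (4 * \<Delta> + 3)"
    by (simp add: algebra_simps)
  finally show ?thesis .
qed

theorem theorem1:
  fixes I1 I2 \<beta> :: real and \<Delta> :: nat
  assumes "I1 > 0" and "I2 > 0"
    and "\<beta> = 5 * I2 / (2 * I1)"
    and "\<beta> * (real \<Delta> - 1)\<^sup>2 < 1"
  shows "\<exists>A. additive_FPTAS_whp A
    {(M :: 'w measure, G :: 'w \<Rightarrow> network) | M G. uniform_random_network I1 I2 \<Delta> M G}"
proof -
  define q where "q = 2 * real (\<Delta> - 1) * I2 / I1"
  have q0: "0 \<le> q" using assms(1,2) by (simp add: q_def)
  have q1: "q \<le> 4 / 5"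
  proof (cases "\<Delta> \<le> 1")
    case False
    define d where "d = real \<Delta> - 1"
    have d: "1 \<le> d" "real (\<Delta> - 1) = d" using False by (auto simp: d_def of_nat_diff)
    \<comment> \<open>As \<open>d \<ge> 1\<close>, passing to \<open>d * d\<close> only enlarges the term and reaches the form of the hypothesis.\<close>
    have "q \<le> 2 * (d * d) * I2 / I1"
      unfolding q_def d(2) using d(1) assms(1,2) by (intro divide_right_mono mult_right_mono mult_left_mono) auto
    also have "\<dots> = 4 / 5 * (\<beta> * d\<^sup>2)" using assms(1) by (simp add: assms(3) power2_eq_square field_simps)
    also have "\<dots> \<le> 4 / 5" using assms(4) by (simp add: d_def)
    finally show ?thesis .
  qed (simp add: q_def)
  have q4: "q ^ (4 * j) \<le> (1 / 2) ^ j" for j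
  proof -
    have "q ^ 4 \<le> (4 / 5) ^ 4" using q0 q1 by (intro power_mono)
    also have "\<dots> \<le> (1 / 2 :: real)" by (simp add: power4_eq_xxxx)
    finally show ?thesis unfolding power_mult using q0 by (intro power_mono) auto
  qed
  \<comment> \<open>Strictly above \<open>2 * \<Delta> * I2 / I1\<close>, which makes the failure probability strictly smaller than \<open>\<epsilon>\<close>.\<close>
  define C where "C = nat \<lceil>2 * real \<Delta> * I2 / I1\<rceil> + 1"
  have C: "2 * real \<Delta> * I2 / I1 < real C" unfolding C_def by linarith
  \<comment> \<open>\<open>G0 * (1 + n) * (1 + 1 / \<epsilon>)\<close> will dominate both \<open>n\<close> and \<open>2 ^ j\<close>.\<close>
  define G0 where "G0 = 2 * real C + 1"
  define c where "c = 500 + 2 * real C + 200 * (5 + 4 * real \<Delta>) * 2 ^ \<Delta>"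
  define p :: "real poly poly" where
    "p = [:[:c:]:] * ([:[:G0:]:] * [:1, 1:] * [:[:1, 1:]:]) ^ (4 * \<Delta> + 3)"
  have p: "poly (poly p [:x:]) y = c * (G0 * (1 + x) * (1 + y)) ^ (4 * \<Delta> + 3)" for x y
    by (simp add: p_def poly_power algebra_simps)
  have "additive_FPTAS_whp (prog, main_exp C)
    {(M :: 'w measure, G :: 'w \<Rightarrow> network) | M G. uniform_random_network I1 I2 \<Delta> M G}"
    unfolding additive_FPTAS_whp_def
  proof (intro exI[of _ p] ballI, clarify)
    fix M :: "'w measure" and G :: "'w \<Rightarrow> network" and \<epsilon> :: real
    assume U: "uniform_random_network I1 I2 \<Delta> M G" and \<epsilon>: "0 < \<epsilon>"
    then obtain n E X where M: "prob_space M" and G: "G = binary_network n E X"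
      and net: "\<And>\<omega>. \<omega> \<in> space M \<Longrightarrow> decision_network (G \<omega>) \<and> max_degree (G \<omega>) \<le> \<Delta>"
      and nodes: "\<And>u. u < n \<Longrightarrow> uniform_on M (X (Node u)) I1"
      and edges: "\<And>e a b. e \<in> E \<Longrightarrow> a < 2 \<Longrightarrow> b < 2 \<Longrightarrow> uniform_on M (X (Edge e a b)) I2"
      and indep: "prob_space.indep_vars M (\<lambda>_. borel) X
          ({Node u | u. u < n} \<union> {Edge e a b | e a b. e \<in> E \<and> a < 2 \<and> b < 2})"
      unfolding uniform_random_network_def by blast
    obtain \<omega>0 where "\<omega>0 \<in> space M" using prob_space.not_empty[OF M] by blast
    then have "decision_network (G \<omega>0)" "max_degree (G \<omega>0) \<le> \<Delta>" using net by auto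
    moreover have "num_nodes (G \<omega>0) = n" "edges (G \<omega>0) = E" by (auto simp: G binary_network_def)
    ultimately have Es: "distinct (edge_list n E)" "set (edge_list n E) = E" "endpoints (edge_list n E) \<subseteq> {..<n}"
      "loopless (edge_list n E)" "length (edge_list n E) \<le> n * n"
      and deg: "\<And>u. length (filter (incident u) (edge_list n E)) \<le> \<Delta>"
      using edge_list[of "G \<omega>0" \<Delta> n E] by auto
    obtain j where j: "real C * real n \<le> 2 ^ j * \<epsilon>" "\<And>i. i < j \<Longrightarrow> 2 ^ i * \<epsilon> < real C * real n"
      "2 ^ j \<le> max 1 (2 * (real C * real n) / \<epsilon>)"
      using doubling_depth[OF \<epsilon>] by metis
    define x where "x = (\<lambda>\<omega>. estimated_solution (4 * j) n (edge_list n E) (\<lambda>i. X i \<omega>))"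
    define Y where "Y = G0 * (1 + real n) * (1 + 1 / \<epsilon>)"
    have nn: "num_nodes (G \<omega>) = n" for \<omega> by (simp add: G binary_network_def)
    have Y1: "(1 + real n) * (1 + 1 / \<epsilon>) = 1 + real n + 1 / \<epsilon> + real n / \<epsilon>"
      by (simp add: algebra_simps add_divide_distrib)
    have G0: "1 \<le> G0" by (simp add: G0_def)
    have nY: "real n \<le> Y"
    proof -
      have "real n \<le> 1 * ((1 + real n) * (1 + 1 / \<epsilon>))" unfolding Y1 using \<epsilon> by simp
      also have "\<dots> \<le> Y" unfolding Y_def mult.assoc using G0 \<epsilon> by (intro mult_right_mono) auto
      finally show ?thesis .
    qed
    have jY: "2 ^ j \<le> Y"
    proof -
      have "0 \<le> 2 * (real C * real n) / \<epsilon>" using \<epsilon> by simp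
      then have "max 1 (2 * (real C * real n) / \<epsilon>) \<le> 1 + 2 * (real C * real n) / \<epsilon>" by simp
      with j(3) have "2 ^ j \<le> 1 + 2 * (real C * real n) / \<epsilon>" by linarith
      also have "\<dots> \<le> G0 * ((1 + real n) * (1 + 1 / \<epsilon>))"
        unfolding Y1 G0_def using \<epsilon> by (simp add: algebra_simps add_divide_distrib)
      finally show ?thesis by (simp add: Y_def mult.assoc)
    qed
    have time: "\<exists>t. outputs_in_time (prog, main_exp C) \<epsilon> (G \<omega>) (x \<omega>) t \<and>
        real t \<le> poly (poly p [:real (num_nodes (G \<omega>)):]) (1 / \<epsilon>)" for \<omega>
    proof -
      obtain t where t: "outputs_in_time (prog, main_exp C) \<epsilon> (G \<omega>) (x \<omega>) t"
        "t \<le> n * (20 * (n + 2 * length (edge_list n E)) + 60 +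
          200 * (length (edge_list n E) + (n + 2 * length (edge_list n E) + \<Delta> * (4 * j)) + 1) * (\<Delta> + 1) ^ (4 * j + 1))
        + 20 * j + 40 * n + 120 * length (edge_list n E) + 2 * C + 200"
        unfolding G x_def using main_outputs[OF deg Es(3,4) j(1), of X \<omega>] j(2)
        by blast
      have "real t \<le> c * Y ^ (4 * \<Delta> + 3)"
        unfolding c_def by (rule time_bound[OF t(2) nY Es(5) jY])
      also have "\<dots> = poly (poly p [:real (num_nodes (G \<omega>)):]) (1 / \<epsilon>)"
        by (simp only: p nn Y_def)
      finally show ?thesis using t(1) by (intro exI[of _ t] conjI)
    qed
    have meas: "{\<omega> \<in> space M. ereal \<epsilon> < optimum (G \<omega>) - objective (G \<omega>) (x \<omega>)} \<in> sets M"
      unfolding G x_def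
    proof (rule measurable_gap[OF Es(1-4)])
      show "X (Node u) \<in> borel_measurable M" if "u < n" for u
        by (rule uniform_on_distr(1)[OF nodes[OF that] assms(1)])
      show "X (Edge e a b) \<in> borel_measurable M" if "e \<in> set (edge_list n E)" "a < 2" "b < 2" for e a b
        using that unfolding Es(2) by (intro uniform_on_distr(1)[OF edges assms(2)])
    qed
    have "measure M {\<omega> \<in> space M. ereal \<epsilon> < optimum (G \<omega>) - objective (G \<omega>) (x \<omega>)} \<le>
        real n * (2 * real \<Delta> * I2 / I1 * q ^ (4 * j))"
      unfolding G x_def q_def
      by (rule prob_gap[OF M assms(1,2) Es(1-4) deg nodes edges indep \<epsilon>])
    also have "\<dots> \<le> real n * (2 * real \<Delta> * I2 / I1 * (1 / 2) ^ j)"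
      using assms(1,2) q4 by (intro mult_left_mono) auto
    also have "\<dots> < \<epsilon>"
    proof (cases "n = 0")
      case False
      have "real n * (2 * real \<Delta> * I2 / I1 * (1 / 2) ^ j) < real n * (real C * (1 / 2) ^ j)"
        using False C by (intro mult_strict_left_mono mult_strict_right_mono) auto
      also have "\<dots> \<le> \<epsilon>" using j(1) by (simp add: power_one_over field_simps)
      finally show ?thesis .
    qed (use \<epsilon> in simp)
    finally show "\<exists>x. (\<forall>\<omega>\<in>space M. \<exists>t. outputs_in_time (prog, main_exp C) \<epsilon> (G \<omega>) (x \<omega>) t \<and>
          real t \<le> poly (poly p [:real (num_nodes (G \<omega>)):]) (1 / \<epsilon>)) \<and>
        {\<omega> \<in> space M. ereal \<epsilon> < optimum (G \<omega>) - objective (G \<omega>) (x \<omega>)} \<in> sets M \<and>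
        measure M {\<omega> \<in> space M. ereal \<epsilon> < optimum (G \<omega>) - objective (G \<omega>) (x \<omega>)} < \<epsilon>"
      using time meas by blast
  qed
  then show ?thesis by blast
qed

end
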